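(* Let $p\in(0,1]$ and suppose that $\mathbb{E}[v^2]<\infty$. Then there exists $c>0$ such that the set $\mathcal{R}=\mathcal{R}(c)$ of renewal points is infinite with probability $1$.
   Context: Model. Fix $p\in(0,1]$. For integers $i<j$ let $v_{i,j}>0$ be i.i.d. random variables with the law of a random variable $v$, assumed not almost surely constant. Independently of the weights, let $\alpha_{i,j}$, $i<j$, be i.i.d. with $\alpha_{i,j}=1$ with probability $p$ (edge $(i,j)$ present) and $\alpha_{i,j}=-\infty$ with probability $1-p$ (edge absent). A path from $i$ to $j$ is a sequence of present edges $(i_0,i_1),\dots,(i_{l-1},i_l)$ with $i=i_0<i_1<\dots<i_l=j$; its weight is the sum of its edge weights. $w_{i,j}$ is the maximal weight of a path from $i$ to $j$, with $w_{i,j}=-\infty$ if there is none. Renewal points. Given a constant $c>0$, a point $x\in\mathbb{Z}$ is a renewal point if all of the following hold: $w_{x,x+l}\ge cl$ for all $l\ge1$; $\alpha_{x-j,x+l}v_{x-j,x+l}<c(l+j)$ for all $j,l\ge1$; $w_{x-l,x}\ge cl$ for all $l\ge1$. $\mathcal{R}$ is the set of renewal points. *)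

theory Defs
  imports "HOL-Probability.Probability"
begin

definition edge_set :: "(int \<times> int) set" where
  "edge_set = {(i, j). i < j}"

text \<open>
  \<open>v\<close> on \<open>N\<close> is the generic weight; the graph lives on \<open>M\<close>. The last assumption says that the
  whole family of weights is independent of the whole family of edge indicators; there the weights are
  embedded into \<open>ereal\<close> only because \<open>indep_var\<close> needs both variables to have the same type.
\<close>

locale weighted_random_dag = prob_space M
  for M :: "'a measure" +
  fixes N :: "'b measure" and v :: "'b \<Rightarrow> real" and p :: real
    and V :: "int \<Rightarrow> int \<Rightarrow> 'a \<Rightarrow> real" and \<alpha> :: "int \<Rightarrow> int \<Rightarrow> 'a \<Rightarrow> ereal"
  assumes p_pos: "0 < p" and p_le_1: "p \<le> 1"
    and prob_space_N: "prob_space N"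
    and v_measurable: "v \<in> borel_measurable N"
    and v_pos: "AE z in N. 0 < v z"
    and v_not_constant: "\<not> (\<exists>a. AE z in N. v z = a)"
    and V_indep: "indep_vars (\<lambda>_. borel) (\<lambda>(i, j). V i j) edge_set"
    and V_law: "\<And>i j. i < j \<Longrightarrow> distr M borel (V i j) = distr N borel v"
    and \<alpha>_indep: "indep_vars (\<lambda>_. borel) (\<lambda>(i, j). \<alpha> i j) edge_set"
    and \<alpha>_present: "\<And>i j. i < j \<Longrightarrow> prob {\<omega> \<in> space M. \<alpha> i j \<omega> = 1} = p"
    and \<alpha>_absent: "\<And>i j. i < j \<Longrightarrow> prob {\<omega> \<in> space M. \<alpha> i j \<omega> = -\<infinity>} = 1 - p"
    and V_\<alpha>_indep:
      "indep_var
        (\<Pi>\<^sub>M e\<in>edge_set. borel) (\<lambda>\<omega>. \<lambda>(i, j)\<in>edge_set. ereal (V i j \<omega>))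
        (\<Pi>\<^sub>M e\<in>edge_set. borel) (\<lambda>\<omega>. \<lambda>(i, j)\<in>edge_set. \<alpha> i j \<omega>)"

text \<open>
  The following notions concern one realisation: \<open>u i j\<close> is the weight of the edge \<open>(i, j)\<close> and
  \<open>a i j\<close> is \<open>1\<close> or \<open>-\<infinity>\<close> according to whether the edge is present or absent. A path is given by the list
  of its vertices.
\<close>

definition paths :: "(int \<Rightarrow> int \<Rightarrow> ereal) \<Rightarrow> int \<Rightarrow> int \<Rightarrow> int list set" where
  "paths a i j =
    {xs. xs \<noteq> [] \<and> hd xs = i \<and> last xs = j \<and> successively (\<lambda>k l. k < l \<and> a k l = 1) xs}"

definition path_weight :: "(int \<Rightarrow> int \<Rightarrow> real) \<Rightarrow> int list \<Rightarrow> real" where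
  "path_weight u xs = (\<Sum>k<length xs - 1. u (xs ! k) (xs ! Suc k))"

text \<open>
  There are only finitely many paths between two vertices, so the supremum is a maximum when
  there is a path; otherwise it is \<open>Sup {} = -\<infinity>\<close>.
\<close>

definition max_weight ::
    "(int \<Rightarrow> int \<Rightarrow> real) \<Rightarrow> (int \<Rightarrow> int \<Rightarrow> ereal) \<Rightarrow> int \<Rightarrow> int \<Rightarrow> ereal" where
  "max_weight u a i j = (SUP xs\<in>paths a i j. ereal (path_weight u xs))"

lemma finite_paths: "finite (paths a i j)"
proof -
  have "sorted_wrt (<) xs" if "xs \<in> paths a i j" for xs
  proof -
    have "successively (<) xs"
      using that by (auto simp: paths_def elim: successively_mono)
    then show ?thesis
      by (simp add: successively_conv_sorted_wrt)
  qed
  moreover have "set xs \<subseteq> {i..j}" if "xs \<in> paths a i j" for xs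
  proof
    fix x assume "x \<in> set xs"
    then obtain k where k: "k < length xs" "x = xs ! k"
      by (auto simp: in_set_conv_nth)
    have s: "sorted xs"
      using calculation[OF that] strict_sorted_imp_sorted by blast
    have "xs ! 0 \<le> xs ! k" "xs ! k \<le> xs ! (length xs - 1)"
      using k by (auto intro!: sorted_nth_mono[OF s])
    then show "x \<in> {i..j}"
      using that k by (auto simp: paths_def hd_conv_nth last_conv_nth)
  qed
  ultimately have "paths a i j \<subseteq> {xs. set xs \<subseteq> {i..j} \<and> distinct xs}"
    using strict_sorted_iff by blast
  then show ?thesis
    using finite_subset finite_subset_distinct[of "{i..j}"] by blast
qed

definition renewal_points ::
    "(int \<Rightarrow> int \<Rightarrow> real) \<Rightarrow> (int \<Rightarrow> int \<Rightarrow> ereal) \<Rightarrow> real \<Rightarrow> int set" where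
  "renewal_points u a c = {x.
    (\<forall>l\<ge>1. max_weight u a x (x + l) \<ge> ereal (c * l)) \<and>
    (\<forall>j\<ge>1. \<forall>l\<ge>1. a (x - j) (x + l) * ereal (u (x - j) (x + l)) < ereal (c * (l + j))) \<and>
    (\<forall>l\<ge>1. max_weight u a (x - l) x \<ge> ereal (c * l))}"

end

theory Submission
  imports Defs
begin

text \<open>
  Absent edges get weight 0; the resulting edge weights are i.i.d., and an edge is present iff its
  weight is positive. Call an edge good if its weight is at least \<open>d\<close>. Being a renewal point follows
  from three conditions on disjoint, hence independent, sets of edges: linearly long paths of good
  edges to the right of the point, the same to its left, and no heavy edge jumping over it.

  The last condition has positive probability for every \<open>c\<close> with \<open>P(weight < 2c) > 0\<close>, by the second
  moment assumption. If the weights are bounded away from 0, one takes \<open>c = d\<close> to be a lower bound of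
  the weights such that \<open>2c\<close> is not a lower bound; then all edges are good. Otherwise \<open>c\<close> may be as
  small as we please, and it suffices that in the random graph of good edges the longest path from 0
  to \<open>l\<close> grows linearly in \<open>l\<close>. Walking back from \<open>l\<close> to the nearest parent each time, the steps
  longer than \<open>k\<close> cover less than half of \<open>{0..l}\<close> for large \<open>k\<close> and \<open>l\<close> (a Chernoff bound), so there
  are at least \<open>l / (2k)\<close> short ones.

  Hence every point is a renewal point with the same positive probability. Truncating the conditions
  to windows of radius \<open>n\<close> makes them independent at points with spacing \<open>2n + 1\<close>, which shows that
  almost surely there are renewal points arbitrarily far to the right.
\<close>

section \<open>Independent families\<close>

context prob_space
begin

text \<open>Beyond a suitable \<open>m\<close> the complements have total probability below 1/2, so
  by the Weierstrass product inequality the remaining factors multiply to more than 1/2. The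
  finitely many factors before \<open>m\<close> are positive, and continuity from above passes to
  the infinite intersection.\<close>

lemma prob_INT_pos:
  assumes indep: "indep_events A (UNIV :: nat set)"
    and pos: "\<And>n. 0 < prob (A n)"
    and summ: "summable (\<lambda>n. 1 - prob (A n))"
  shows "0 < prob (\<Inter>n. A n)"
proof -
  have A [measurable]: "A n \<in> events" for n
    using indep by (auto simp: indep_events_def)
  have "\<exists>m. \<forall>n\<ge>m. norm (\<Sum>i. 1 - prob (A (i + n))) < 1/2"
    by (rule suminf_exist_split[OF _ summ]) simp
  then obtain m where "norm (\<Sum>n. 1 - prob (A (n + m))) < 1/2"
    by blast
  then have m: "(\<Sum>n. 1 - prob (A (n + m))) < 1/2"
    unfolding real_norm_def by linarith
  define q where "q = (\<Prod>n<m. prob (A n)) / 2"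
  have "0 < q"
    using pos by (auto simp: q_def intro!: prod_pos)
  have le: "q \<le> prob (\<Inter>n\<le>N. A n)" if "m \<le> N" for N
  proof -
    have "(\<Sum>n=m..N. 1 - prob (A n)) = (\<Sum>n\<le>N-m. 1 - prob (A (n + m)))"
      using that by (intro sum.reindex_bij_witness[of _ "\<lambda>n. n + m" "\<lambda>n. n - m"]) auto
    also have "\<dots> \<le> (\<Sum>n. 1 - prob (A (n + m)))"
      using summ by (intro sum_le_suminf summable_ignore_initial_segment) auto
    finally have "1/2 \<le> 1 - (\<Sum>n=m..N. 1 - prob (A n))"
      using m by simp
    also have "\<dots> \<le> (\<Prod>n=m..N. 1 - (1 - prob (A n)))"
      by (intro Weierstrass_prod_ineq) auto
    finally have "q \<le> (\<Prod>n<m. prob (A n)) * (\<Prod>n=m..N. prob (A n))"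
      using mult_left_mono[of "1/2" "\<Prod>n=m..N. prob (A n)" "\<Prod>n<m. prob (A n)"]
      by (simp add: q_def prod_nonneg)
    also have "\<dots> = (\<Prod>n\<in>{..<m} \<union> {m..N}. prob (A n))"
      by (intro prod.union_disjoint[symmetric]) auto
    also have "{..<m} \<union> {m..N} = {..N}"
      using that by auto
    also have "(\<Prod>n\<le>N. prob (A n)) = prob (\<Inter>n\<le>N. A n)"
      using indep by (auto simp: indep_events_def)
    finally show ?thesis .
  qed
  have "(\<lambda>N. prob (\<Inter>n\<le>N. A n)) \<longlonglongrightarrow> prob (\<Inter>N. \<Inter>n\<le>N. A n)"
    by (intro finite_Lim_measure_decseq) (auto simp: decseq_def)
  then have "q \<le> prob (\<Inter>N. \<Inter>n\<le>N. A n)"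
    using le by (intro LIMSEQ_le_const) auto
  also have "(\<Inter>N. \<Inter>n\<le>N. A n) = (\<Inter>n. A n)"
    by blast
  finally show ?thesis
    using \<open>0 < q\<close> by simp
qed

lemma indep_varsI:
  assumes "\<And>i. i \<in> I \<Longrightarrow> random_variable (M' i) (X i)"
    and "\<And>J A. J \<noteq> {} \<Longrightarrow> J \<subseteq> I \<Longrightarrow> finite J \<Longrightarrow> (\<And>j. j \<in> J \<Longrightarrow> A j \<in> sets (M' j)) \<Longrightarrow>
      prob (\<Inter>j\<in>J. X j -` A j \<inter> space M) = (\<Prod>j\<in>J. prob (X j -` A j \<inter> space M))"
  shows "indep_vars M' X I"
  unfolding indep_vars_def2
proof (intro conjI ballI indep_setsI)
  fix J B
  assume J: "J \<noteq> {}" "J \<subseteq> I" "finite J"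
    and "\<forall>j\<in>J. B j \<in> {X j -` A \<inter> space M |A. A \<in> sets (M' j)}"
  then have "\<forall>j\<in>J. \<exists>A. B j = X j -` A \<inter> space M \<and> A \<in> sets (M' j)"
    by blast
  then obtain A where A: "\<forall>j\<in>J. B j = X j -` A j \<inter> space M \<and> A j \<in> sets (M' j)"
    by metis
  then show "prob (\<Inter>j\<in>J. B j) = (\<Prod>j\<in>J. prob (B j))"
    using assms(2)[OF J, of A] by simp
qed (use assms(1) in \<open>auto intro: measurable_sets\<close>)

text \<open>Serves to translate the weights to a window around another point and to read the edges
  of a half-line as a graph on the natural numbers.\<close>

lemma indep_vars_reindex:
  assumes "indep_vars M' X I" "inj_on f J" "f ` J \<subseteq> I"
  shows "indep_vars (\<lambda>j. M' (f j)) (\<lambda>j. X (f j)) J"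
proof (rule indep_varsI)
  fix j assume "j \<in> J"
  then show "random_variable (M' (f j)) (X (f j))"
    using assms by (auto simp: indep_vars_def)
next
  fix L A
  assume L: "L \<noteq> {}" "L \<subseteq> J" "finite L" and A: "\<And>j. j \<in> L \<Longrightarrow> A j \<in> sets (M' (f j))"
  have inj: "inj_on f L"
    using assms(2) L(2) by (rule inj_on_subset)
  define B where "B = (\<lambda>i. A (inv_into L f i))"
  have "prob (\<Inter>i\<in>f ` L. X i -` B i \<inter> space M) = (\<Prod>i\<in>f ` L. prob (X i -` B i \<inter> space M))"
    using L assms(3) A by (intro indep_varsD[OF assms(1)]) (auto simp: B_def inv_into_f_f[OF inj])
  then show "prob (\<Inter>j\<in>L. X (f j) -` A j \<inter> space M) = (\<Prod>j\<in>L. prob (X (f j) -` A j \<inter> space M))"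
    using L(1) by (simp add: prod.reindex[OF inj] B_def inv_into_f_f[OF inj])
qed

text \<open>The random vectors formed from disjoint blocks of independent variables are independent.
  \<open>Q\<close> sees only the block \<open>K k\<close>, as measurability on that product demands,
  while \<open>Q'\<close> speaks of the whole realisation; the conclusion in terms of
  \<open>Q'\<close> is free of restricted functions.\<close>

lemma indep_events_groups:
  assumes indep: "indep_vars M' X I"
    and K: "\<And>k. k \<in> L \<Longrightarrow> K k \<subseteq> I" "disjoint_family_on K L"
    and Q: "\<And>k. k \<in> L \<Longrightarrow> {g \<in> space (PiM (K k) M'). Q k g} \<in> sets (PiM (K k) M')"
    and Q': "\<And>k \<omega>. k \<in> L \<Longrightarrow> \<omega> \<in> space M \<Longrightarrow> Q k (\<lambda>i\<in>K k. X i \<omega>) \<longleftrightarrow> Q' k \<omega>"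
  shows "indep_events (\<lambda>k. {\<omega> \<in> space M. Q' k \<omega>}) L"
proof -
  have "indep_events (\<lambda>k. {\<omega> \<in> space M. Q k (\<lambda>i\<in>K k. X i \<omega>)}) L"
    using indep_vars_restrict[OF indep K] Q by (rule indep_eventsI_indep_vars)
  moreover have "{\<omega> \<in> space M. Q k (\<lambda>i\<in>K k. X i \<omega>)} = {\<omega> \<in> space M. Q' k \<omega>}" if "k \<in> L" for k
    using Q' that by auto
  ultimately show ?thesis
    unfolding indep_events_def_alt by (subst indep_sets_cong[OF refl, symmetric]) auto
qed

end

section \<open>Longest paths in random directed graphs\<close>

text \<open>
  The clause \<open>d = j\<close> only serves to make the least element exist when \<open>j\<close> has no parent; the truncated
  difference \<open>j - d\<close> is harmless, since the least element is at most \<open>j\<close>.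
\<close>

definition parent_dist :: "(nat \<times> nat \<Rightarrow> bool) \<Rightarrow> nat \<Rightarrow> nat" where
  "parent_dist z j = (LEAST d. d = j \<or> 0 < d \<and> z (j - d, j))"

text \<open>Summed over all vertices up to \<open>j\<close>, this bounds the length covered by the
  long steps of the backward walk from \<open>j\<close>. Unlike the walk, whose vertices depend on
  each other, it is a sum of independent terms.\<close>

definition long_dist :: "nat \<Rightarrow> (nat \<times> nat \<Rightarrow> bool) \<Rightarrow> nat \<Rightarrow> nat" where
  "long_dist k z j = (if k < parent_dist z j then parent_dist z j else 0)"

section \<open>Nearest parents and long steps in a fixed graph\<close>

lemma parent_dist_le: "parent_dist z j \<le> j"
  unfolding parent_dist_def by (rule Least_le) simp

lemma parent_dist_pos: "0 < parent_dist z j" if "0 < j"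
  using LeastI[of "\<lambda>d. d = j \<or> 0 < d \<and> z (j - d, j)" j] that
  unfolding parent_dist_def by auto

lemma parent_dist_edge:
  assumes "i < j" "z (i, j)"
  shows "z (j - parent_dist z j, j)"
proof -
  have "parent_dist z j \<le> j - i"
    using assms unfolding parent_dist_def by (intro Least_le) auto
  moreover have "parent_dist z j = j \<or> z (j - parent_dist z j, j)"
    using LeastI[of "\<lambda>d. d = j \<or> 0 < d \<and> z (j - d, j)" j] unfolding parent_dist_def by auto
  ultimately show ?thesis
    using assms by (cases "i = 0") auto
qed

lemma no_edge_below_parent_dist:
  assumes "0 < e" "e < parent_dist z j"
  shows "\<not> z (j - e, j)"
  using not_less_Least[of e "\<lambda>d. d = j \<or> 0 < d \<and> z (j - d, j)"] assms
  unfolding parent_dist_def by auto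

text \<open>Step back from \<open>j\<close> to its nearest parent and apply induction there. A step
  of length at most \<open>k\<close> is paid for by the increase of \<open>k * m\<close>, a longer
  one by its own term in the sum.\<close>

lemma long_path:
  assumes parents: "\<And>j. 0 < j \<Longrightarrow> \<exists>i<j. z (i, j)"
  shows "\<exists>m. (0, j) \<in> {(i, j). i < j \<and> z (i, j)} ^^ m \<and> j \<le> k * m + (\<Sum>i=1..j. long_dist k z i)"
proof (induction j rule: less_induct)
  case (less j)
  show ?case
  proof (cases "j = 0")
    case True
    then show ?thesis
      by (intro exI[of _ 0]) auto
  next
    case False
    define d where "d = parent_dist z j"
    have d: "0 < d" "d \<le> j"
      using False parent_dist_pos parent_dist_le by (auto simp: d_def)
    have edge: "z (j - d, j)"
      using parents[of j] False parent_dist_edge unfolding d_def by blast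
    obtain m where m: "(0, j - d) \<in> {(i, j). i < j \<and> z (i, j)} ^^ m"
        "j - d \<le> k * m + (\<Sum>i=1..j - d. long_dist k z i)"
      using less.IH[of "j - d"] d False by auto
    have "(0, j) \<in> {(i, j). i < j \<and> z (i, j)} ^^ Suc m"
      using m(1) edge d by auto
    moreover have "j \<le> k * Suc m + (\<Sum>i=1..j. long_dist k z i)"
    proof (cases "d \<le> k")
      case True
      have "(\<Sum>i=1..j - d. long_dist k z i) \<le> (\<Sum>i=1..j. long_dist k z i)"
        by (intro sum_mono2) auto
      then show ?thesis
        using m(2) True by simp
    next
      case False
      \<comment> \<open>Since \<open>d > 0\<close>, the vertex \<open>j\<close> is not among those
        summed so far, and its term is exactly \<open>d\<close>.\<close>
      have "(\<Sum>i=1..j - d. long_dist k z i) + d = (\<Sum>i\<in>insert j {1..j - d}. long_dist k z i)"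
        using d False by (subst sum.insert) (auto simp: long_dist_def d_def)
      also have "\<dots> \<le> (\<Sum>i=1..j. long_dist k z i)"
        using d by (intro sum_mono2) auto
      finally show ?thesis
        using m(2) by simp
    qed
    ultimately show ?thesis
      by blast
  qed
qed

text \<open>Countability of the vertex set makes the intermediate vertex of a composition range over
  a countable union.\<close>

lemma measurable_relpow [measurable (raw)]:
  fixes r :: "'a \<Rightarrow> ('b :: countable) rel"
  assumes [measurable]: "\<And>i j. Measurable.pred M (\<lambda>\<omega>. (i, j) \<in> r \<omega>)"
  shows "Measurable.pred M (\<lambda>\<omega>. (i, j) \<in> r \<omega> ^^ m)"
proof (induction m arbitrary: j)
  case (Suc m)
  note Suc [measurable]
  have "Measurable.pred M (\<lambda>\<omega>. \<exists>l. (i, l) \<in> r \<omega> ^^ m \<and> (l, j) \<in> r \<omega>)"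
    by measurable
  then show ?case
    by (simp add: relcomp_unfold)
qed simp

lemma prod_mono_ennreal:
  fixes f g :: "'i \<Rightarrow> ennreal"
  assumes "\<And>i. i \<in> A \<Longrightarrow> f i \<le> g i"
  shows "prod f A \<le> prod g A"
  using assms by (induction A rule: infinite_finite_induct) (auto intro: mult_mono)

section \<open>Random graphs with independent edges of equal probability\<close>

context prob_space
begin

context
  fixes Z :: "nat \<times> nat \<Rightarrow> 'a \<Rightarrow> bool" and q :: real
  assumes indep: "indep_vars (\<lambda>_. count_space UNIV) Z {(i, j). i < j}"
    and prob: "\<And>i j. i < j \<Longrightarrow> prob {\<omega> \<in> space M. Z (i, j) \<omega>} = q"
    and q: "0 < q" "q \<le> 1"
begin

lemma Z_measurable: "i < j \<Longrightarrow> Measurable.pred M (Z (i, j))"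
  using indep by (auto simp: indep_vars_def)

lemma prob_no_edges:
  assumes "finite J" "J \<subseteq> {(i, j). i < j}"
  shows "prob {\<omega> \<in> space M. \<forall>e\<in>J. \<not> Z e \<omega>} = (1 - q) ^ card J"
proof (cases "J = {}")
  case False
  have "{\<omega> \<in> space M. \<forall>e\<in>J. \<not> Z e \<omega>} = (\<Inter>e\<in>J. Z e -` {False} \<inter> space M)"
    using False by auto
  also have "prob \<dots> = (\<Prod>e\<in>J. prob (Z e -` {False} \<inter> space M))"
    using False assms by (intro indep_varsD[OF indep]) auto
  also have "\<dots> = (\<Prod>e\<in>J. 1 - q)"
  proof (rule prod.cong)
    fix e assume "e \<in> J"
    then obtain i j where e: "e = (i, j)" "i < j"
      using assms(2) by (cases e) auto
    have "Z e -` {False} \<inter> space M = space M - {\<omega> \<in> space M. Z (i, j) \<omega>}"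
      using e by auto
    then show "prob (Z e -` {False} \<inter> space M) = 1 - q"
      using e Z_measurable by (simp add: prob_compl prob)
  qed simp
  finally show ?thesis
    by simp
qed (simp add: prob_space)

text \<open>Vertex \<open>n + 1\<close> is without a parent with probability
  \<open>(1 - q) ^ (n + 1)\<close>, which is summable, and for different vertices these events
  concern disjoint sets of edges, so \<open>prob_INT_pos\<close> applies.\<close>

lemma prob_all_parents: "0 < prob {\<omega> \<in> space M. \<forall>j>0. \<exists>i<j. Z (i, j) \<omega>}"
proof -
  note Z_measurable [measurable]
  define A where "A = (\<lambda>n. {\<omega> \<in> space M. \<exists>i\<le>n. Z (i, Suc n) \<omega>})"
  have all_pos: "(\<forall>j>0. P j) \<longleftrightarrow> (\<forall>n. P (Suc n))" for P :: "nat \<Rightarrow> bool"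
    by (metis gr0_conv_Suc zero_less_Suc)
  have "indep_events A UNIV"
    unfolding A_def
  proof (rule indep_events_groups[OF indep, where K = "\<lambda>n. (\<lambda>i. (i, Suc n)) ` {..n}"
        and Q = "\<lambda>n g. \<exists>i\<le>n. g (i, Suc n)"])
    fix n :: nat
    have "Measurable.pred (Pi\<^sub>M ((\<lambda>i. (i, Suc n)) ` {..n}) (\<lambda>_. count_space UNIV))
        (\<lambda>g. \<exists>i\<in>{..n}. g (i, Suc n))"
      by (intro pred_intros_countable_bounded measurable_component_singleton) auto
    then show "{g \<in> space (Pi\<^sub>M ((\<lambda>i. (i, Suc n)) ` {..n}) (\<lambda>_. count_space UNIV)). \<exists>i\<le>n. g (i, Suc n)}
        \<in> sets (Pi\<^sub>M ((\<lambda>i. (i, Suc n)) ` {..n}) (\<lambda>_. count_space UNIV))"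
      by (simp add: pred_def Bex_def)
  qed (auto simp: disjoint_family_on_def)
  moreover have A: "prob (A n) = 1 - (1 - q) ^ Suc n" for n
  proof -
    have "A n = space M - {\<omega> \<in> space M. \<forall>e\<in>(\<lambda>i. (i, Suc n)) ` {..n}. \<not> Z e \<omega>}"
      by (auto simp: A_def)
    moreover have "prob {\<omega> \<in> space M. \<forall>e\<in>(\<lambda>i. (i, Suc n)) ` {..n}. \<not> Z e \<omega>} = (1 - q) ^ Suc n"
      by (subst prob_no_edges) (auto simp: card_image inj_on_def)
    moreover have "{\<omega> \<in> space M. \<forall>e\<in>(\<lambda>i. (i, Suc n)) ` {..n}. \<not> Z e \<omega>} \<in> events"
      by measurable auto
    ultimately show ?thesis
      by (simp add: prob_compl)
  qed
  moreover have "0 < prob (A n)" for n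
    \<comment> \<open>The strict bound on the power is for a positive base, so \<open>q = 1\<close>
      is treated apart.\<close>
    using q power_Suc_less_one[of "1 - q" n] unfolding A
    by (cases "q = 1") auto
  moreover have "summable (\<lambda>n. 1 - prob (A n))"
    unfolding A using q by (simp add: summable_mult summable_geometric)
  ultimately have "0 < prob (\<Inter>n. A n)"
    by (intro prob_INT_pos)
  also have "(\<Inter>n. A n) = {\<omega> \<in> space M. \<forall>j>0. \<exists>i<j. Z (i, j) \<omega>}"
    unfolding all_pos by (auto simp: A_def less_Suc_eq_le)
  finally show ?thesis .
qed

lemma pred_parent_dist:
  fixes j :: nat
  assumes "0 < j"
  shows "Measurable.pred (Pi\<^sub>M ((\<lambda>i. (i, j)) ` {..<j}) (\<lambda>_. count_space UNIV))
    (\<lambda>g. d = j \<or> 0 < d \<and> g (j - d, j))"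
proof (cases "0 < d")
  case True
  \<comment> \<open>By truncated subtraction \<open>j - d\<close> lies in \<open>{..<j}\<close> for
    every \<open>d > 0\<close>, even for \<open>d > j\<close>, so the coordinate belongs to the
    product.\<close>
  then have "(\<lambda>g. g (j - d, j)) \<in> measurable
      (Pi\<^sub>M ((\<lambda>i. (i, j)) ` {..<j}) (\<lambda>_. count_space UNIV)) (count_space (UNIV :: bool set))"
    using assms by (intro measurable_component_singleton image_eqI[where x = "j - d"]) auto
  then show ?thesis
    by measurable
qed simp

text \<open>The value at \<open>j\<close> is determined by the edges ending in \<open>j\<close>, and
  these sets of edges are disjoint for distinct \<open>j\<close>.\<close>

lemma indep_long_dist:
  "indep_vars (\<lambda>_. count_space UNIV) (\<lambda>j \<omega>. long_dist k (\<lambda>e. Z e \<omega>) j) {1..}"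
proof -
  let ?K = "\<lambda>j. (\<lambda>i. (i, j)) ` {..<j}"
  let ?P = "\<lambda>j. Pi\<^sub>M (?K j) (\<lambda>_. count_space (UNIV :: bool set))"
  have "(\<lambda>g. parent_dist g j) \<in> measurable (?P j) (count_space UNIV)" if "j \<in> {1..}" for j
    unfolding parent_dist_def using that by (intro measurable_Least pred_parent_dist) auto
  then have meas: "(\<lambda>g. long_dist k g j) \<in> measurable (?P j) (count_space UNIV)" if "j \<in> {1..}" for j
    unfolding long_dist_def using that by measurable
  have "indep_vars (\<lambda>_. count_space UNIV) (\<lambda>j \<omega>. long_dist k (\<lambda>e\<in>?K j. Z e \<omega>) j) {1..}"
    by (rule indep_vars_compose2[OF indep_vars_restrict[OF indep] meas])
       (auto simp: disjoint_family_on_def)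
  also have "?this \<longleftrightarrow> ?thesis"
  proof (rule indep_vars_cong)
    fix j :: nat assume j: "j \<in> {1..}"
    have "(d = j \<or> 0 < d \<and> (\<lambda>e\<in>?K j. Z e \<omega>) (j - d, j)) \<longleftrightarrow> (d = j \<or> 0 < d \<and> Z (j - d, j) \<omega>)" for d \<omega>
      using j by auto
    then show "(\<lambda>\<omega>. long_dist k (\<lambda>e\<in>?K j. Z e \<omega>) j) = (\<lambda>\<omega>. long_dist k (\<lambda>e. Z e \<omega>) j)"
      unfolding long_dist_def parent_dist_def by presburger
  qed auto
  finally show ?thesis .
qed

lemma long_dist_Z_measurable:
  "0 < j \<Longrightarrow> (\<lambda>\<omega>. long_dist k (\<lambda>e. Z e \<omega>) j) \<in> measurable M (count_space UNIV)"
  using indep_long_dist[of k] by (auto simp: indep_vars_def)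

text \<open>A value \<open>d > k\<close> forces the \<open>d - 1\<close> vertices nearest to
  \<open>j\<close> not to be parents, an event of probability \<open>(1 - q) ^ (d - 1)\<close>. The
  summand 1 covers the value 0. The sum stops at \<open>j\<close> because no distance exceeds
  \<open>j\<close>.\<close>

lemma nn_integral_long_dist_le:
  assumes b: "1 \<le> b" and j: "0 < j"
  shows "(\<integral>\<^sup>+\<omega>. ennreal (b ^ long_dist k (\<lambda>e. Z e \<omega>) j) \<partial>M)
    \<le> ennreal (1 + (\<Sum>d=k+1..j. b ^ d * (1 - q) ^ (d - 1)))"
proof -
  note Z_measurable [measurable]
  define far where "far = (\<lambda>d. {\<omega> \<in> space M. \<forall>e\<in>(\<lambda>e. (j - e, j)) ` {1..<d}. \<not> Z e \<omega>})"
  have far: "far d \<in> events" if "1 \<le> d" "d \<le> j" for d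
    unfolding far_def by measurable (use that in \<open>auto intro!: Z_measurable\<close>)
  have prob_far: "prob (far d) = (1 - q) ^ (d - 1)" if "1 \<le> d" "d \<le> j" for d
  proof -
    have "inj_on (\<lambda>e. (j - e, j)) {1..<d}"
      using that by (auto simp: inj_on_def)
    then show ?thesis
      unfolding far_def using that j by (subst prob_no_edges) (auto simp: card_image)
  qed
  have "(\<integral>\<^sup>+\<omega>. ennreal (b ^ long_dist k (\<lambda>e. Z e \<omega>) j) \<partial>M)
      \<le> (\<integral>\<^sup>+\<omega>. 1 + (\<Sum>d=k+1..j. ennreal (b ^ d) * indicator (far d) \<omega>) \<partial>M)"
  proof (rule nn_integral_mono)
    fix \<omega> assume \<omega>: "\<omega> \<in> space M"
    define d where "d = parent_dist (\<lambda>e. Z e \<omega>) j"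
    show "ennreal (b ^ long_dist k (\<lambda>e. Z e \<omega>) j)
        \<le> 1 + (\<Sum>d=k+1..j. ennreal (b ^ d) * indicator (far d) \<omega>)"
    proof (cases "k < d")
      case True
      have "\<omega> \<in> far d"
        using no_edge_below_parent_dist[of _ "\<lambda>e. Z e \<omega>" j] \<omega> by (auto simp: far_def d_def)
      then have "ennreal (b ^ long_dist k (\<lambda>e. Z e \<omega>) j) = ennreal (b ^ d) * indicator (far d) \<omega>"
        using True by (simp add: long_dist_def d_def)
      also have "\<dots> \<le> (\<Sum>d=k+1..j. ennreal (b ^ d) * indicator (far d) \<omega>)"
        using True parent_dist_le[of _ j] by (intro member_le_sum) (auto simp: d_def)
      finally show ?thesis
        by (simp add: add_increasing)
    qed (simp add: long_dist_def d_def)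
  qed
  also have "\<dots> = 1 + (\<Sum>d=k+1..j. \<integral>\<^sup>+\<omega>. ennreal (b ^ d) * indicator (far d) \<omega> \<partial>M)"
  proof -
    have "(\<lambda>\<omega>. ennreal (b ^ d) * indicator (far d) \<omega>) \<in> borel_measurable M" if "d \<in> {k+1..j}" for d
      using far[of d] that by simp
    then show ?thesis
      by (subst nn_integral_add, simp, intro borel_measurable_sum, simp,
          subst nn_integral_sum) (simp_all add: emeasure_space_1 del: sum_mult_indicator)
  qed
  also have "\<dots> = 1 + (\<Sum>d=k+1..j. ennreal (b ^ d * (1 - q) ^ (d - 1)))"
    using far prob_far b
    by (intro arg_cong2[where f = "(+)"] sum.cong)
       (auto simp: nn_integral_cmult_indicator emeasure_eq_measure ennreal_mult')
  also have "\<dots> = ennreal (1 + (\<Sum>d=k+1..j. b ^ d * (1 - q) ^ (d - 1)))"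
    using b q by (subst ennreal_plus) (auto simp: sum_ennreal intro!: sum_nonneg)
  finally show ?thesis .
qed

text \<open>Chernoff bound: the sum \<open>S l\<close> satisfies
  \<open>E b ^ S l \<le> \<beta> ^ l\<close> with \<open>b = \<beta> ^ 4\<close>, so Markov's
  inequality bounds the probability of \<open>l \<le> 2 * S l\<close> by
  \<open>\<beta> ^ l / \<beta> ^ (2 * l)\<close>. This is summable in \<open>l\<close>, and
  Borel-Cantelli concludes.\<close>

lemma eventually_sum_long_dist_less:
  "\<exists>k. AE \<omega> in M. eventually (\<lambda>l. 2 * (\<Sum>j=1..l. long_dist k (\<lambda>e. Z e \<omega>) j) < l) sequentially"
proof -
  \<comment> \<open>Any \<open>b\<close> strictly between 1 and \<open>1 / (1 - q)\<close> makes the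
    geometric series below converge; this choice also covers \<open>q = 1\<close>.\<close>
  define b where "b = 2 / (2 - q)"
  \<comment> \<open>With the fourth root, \<open>l \<le> 2 * S l\<close> yields
    \<open>b ^ S l \<ge> \<beta> ^ (2 * l)\<close>, which exceeds the bound
    \<open>\<beta> ^ l\<close> on the mean by a factor that grows geometrically.\<close>
  define \<beta> where "\<beta> = root 4 b"
  have b: "1 < b" "b * (1 - q) < 1"
    using q by (auto simp: b_def field_simps)
  have \<beta>: "1 < \<beta>" "\<beta> ^ 4 = b"
    using b by (auto simp: \<beta>_def)
  have "summable (\<lambda>d. b * (b * (1 - q)) ^ d)"
    using b q by (intro summable_mult summable_geometric) auto
  then have summ: "summable (\<lambda>d. b ^ Suc d * (1 - q) ^ d)"
    by (simp add: power_mult_distrib mult_ac)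
  \<comment> \<open>The threshold \<open>k\<close> is taken so large that the steps longer than
    \<open>k\<close> raise the mean of each factor from 1 to at most \<open>\<beta>\<close>,
    uniformly in the vertex.\<close>
  have "\<exists>k. \<forall>n\<ge>k. norm (\<Sum>d. b ^ Suc (d + n) * (1 - q) ^ (d + n)) < \<beta> - 1"
    by (rule suminf_exist_split[OF _ summ]) (use \<beta> in simp)
  then obtain k where "norm (\<Sum>d. b ^ Suc (d + k) * (1 - q) ^ (d + k)) < \<beta> - 1"
    by blast
  then have k: "(\<Sum>d. b ^ Suc (d + k) * (1 - q) ^ (d + k)) < \<beta> - 1"
    unfolding real_norm_def by linarith
  have tail: "1 + (\<Sum>d=k+1..j. b ^ d * (1 - q) ^ (d - 1)) \<le> \<beta>" for j
  proof -
    have "(\<Sum>d=k+1..j. b ^ d * (1 - q) ^ (d - 1)) = (\<Sum>d<j-k. b ^ Suc (d + k) * (1 - q) ^ (d + k))"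
      by (intro sum.reindex_bij_witness[of _ "\<lambda>d. d + k + 1" "\<lambda>d. d - k - 1"]) auto
    also have "\<dots> \<le> (\<Sum>d. b ^ Suc (d + k) * (1 - q) ^ (d + k))"
      using summable_ignore_initial_segment[OF summ, of k] b q by (intro sum_le_suminf) auto
    finally show ?thesis
      using k by simp
  qed
  define S where "S = (\<lambda>l \<omega>. \<Sum>j=1..l. long_dist k (\<lambda>e. Z e \<omega>) j)"
  note long_dist_Z_measurable [measurable]
  have S [measurable]: "S l \<in> measurable M (count_space UNIV)" for l
    unfolding S_def by measurable
  have mgf: "(\<integral>\<^sup>+\<omega>. ennreal (b ^ S l \<omega>) \<partial>M) \<le> ennreal (\<beta> ^ l)" for l
  proof -
    have "(\<integral>\<^sup>+\<omega>. ennreal (b ^ S l \<omega>) \<partial>M) = (\<integral>\<^sup>+\<omega>. (\<Prod>j=1..l. ennreal (b ^ long_dist k (\<lambda>e. Z e \<omega>) j)) \<partial>M)"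
      using b by (simp add: S_def power_sum prod_ennreal)
    also have "\<dots> = (\<Prod>j=1..l. \<integral>\<^sup>+\<omega>. ennreal (b ^ long_dist k (\<lambda>e. Z e \<omega>) j) \<partial>M)"
      by (intro indep_vars_nn_integral
          indep_vars_compose2[OF indep_vars_subset[OF indep_long_dist]]) auto
    also have "\<dots> \<le> (\<Prod>j=1..l. ennreal \<beta>)"
    proof (rule prod_mono_ennreal)
      fix j assume "j \<in> {1..l}"
      then have "(\<integral>\<^sup>+\<omega>. ennreal (b ^ long_dist k (\<lambda>e. Z e \<omega>) j) \<partial>M)
          \<le> ennreal (1 + (\<Sum>d=k+1..j. b ^ d * (1 - q) ^ (d - 1)))"
        using b by (intro nn_integral_long_dist_le) auto
      also have "\<dots> \<le> ennreal \<beta>"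
        by (intro ennreal_leI tail)
      finally show "(\<integral>\<^sup>+\<omega>. ennreal (b ^ long_dist k (\<lambda>e. Z e \<omega>) j) \<partial>M) \<le> ennreal \<beta>" .
    qed
    also have "\<dots> = ennreal (\<beta> ^ l)"
      using \<beta> by (simp add: ennreal_power)
    finally show ?thesis .
  qed
  have bound: "prob {\<omega> \<in> space M. l \<le> 2 * S l \<omega>} \<le> (1 / \<beta>) ^ l" for l
  proof -
    let ?B = "{\<omega> \<in> space M. 1 \<le> ennreal (1 / \<beta> ^ (2 * l)) * ennreal (b ^ S l \<omega>)}"
    have "prob {\<omega> \<in> space M. l \<le> 2 * S l \<omega>} \<le> prob ?B"
    proof (intro finite_measure_mono subsetI)
      fix \<omega> assume \<omega>: "\<omega> \<in> {\<omega> \<in> space M. l \<le> 2 * S l \<omega>}"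
      then have "\<beta> ^ (2 * l) \<le> \<beta> ^ (4 * S l \<omega>)"
        using \<beta> by (intro power_increasing) auto
      then have "1 \<le> 1 / \<beta> ^ (2 * l) * b ^ S l \<omega>"
        using \<beta> by (simp add: power_mult)
      then show "\<omega> \<in> ?B"
        using \<omega> b \<beta> by (simp flip: ennreal_mult)
    qed measurable
    also have "prob ?B \<le> (1 / \<beta>) ^ l"
    proof -
      have "ennreal (prob ?B)
          \<le> ennreal (1 / \<beta> ^ (2 * l)) * (\<integral>\<^sup>+\<omega>. ennreal (b ^ S l \<omega>) * indicator (space M) \<omega> \<partial>M)"
        unfolding emeasure_eq_measure[symmetric] by (intro nn_integral_Markov_inequality) auto
      also have "\<dots> \<le> ennreal (1 / \<beta> ^ (2 * l)) * ennreal (\<beta> ^ l)"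
        using mgf[of l] by (intro mult_left_mono) (auto cong: nn_integral_cong)
      also have "\<dots> = ennreal ((1 / \<beta>) ^ l)"
        using \<beta> by (simp add: power_one_over mult_2 power_add flip: ennreal_mult)
      finally show ?thesis
        using \<beta> by simp
    qed
    finally show ?thesis .
  qed
  have "summable (\<lambda>l. prob {\<omega> \<in> space M. l \<le> 2 * S l \<omega>})"
    using bound \<beta> by (intro summable_comparison_test[OF _ summable_geometric[of "1 / \<beta>"]]) auto
  then have "AE \<omega> in M. eventually (\<lambda>l. \<omega> \<in> space M - {\<omega> \<in> space M. l \<le> 2 * S l \<omega>}) sequentially"
    by (intro borel_cantelli_AE1) (auto simp: emeasure_eq_measure)
  then have "AE \<omega> in M. eventually (\<lambda>l. 2 * S l \<omega> < l) sequentially"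
    by (rule AE_mp) (auto elim!: eventually_mono)
  then show ?thesis
    unfolding S_def by blast
qed

text \<open>On the event that all parents exist, the path of \<open>long_path\<close> satisfies
  \<open>l \<le> 2 * k * m\<close> once the long steps cover less than half of \<open>l\<close>.
  This holds from some random \<open>L\<close> on, and a larger factor repairs smaller
  \<open>l\<close>. So almost all of that event lies in the union of the \<open>G n\<close>, which
  therefore cannot all be null.\<close>

lemma linear_paths:
  "\<exists>n\<ge>1. 0 < prob {\<omega> \<in> space M. \<forall>l. \<exists>m. (0, l) \<in> {(i, j). i < j \<and> Z (i, j) \<omega>} ^^ m \<and> l \<le> n * m}"
proof (rule ccontr)
  define G where "G = (\<lambda>n. {\<omega> \<in> space M. \<forall>l. \<exists>m. (0, l) \<in> {(i, j). i < j \<and> Z (i, j) \<omega>} ^^ m \<and> l \<le> n * m})"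
  have "Measurable.pred M (\<lambda>\<omega>. (i, j) \<in> {(i, j). i < j \<and> Z (i, j) \<omega>})" for i j
    using Z_measurable[of i j] by (cases "i < j") auto
  note this [measurable] Z_measurable [measurable]
  have [measurable]: "G n \<in> events" for n
    unfolding G_def by measurable
  assume "\<not> ?thesis"
  then have "prob (G n) = 0" if "n \<ge> 1" for n
    using that measure_nonneg[of M "G n"] unfolding G_def by (meson linorder_not_less order_antisym)
  then have "AE \<omega> in M. \<omega> \<notin> G n" if "n \<ge> 1" for n
    using that by (intro AE_not_in) (auto simp: null_sets_def emeasure_eq_measure)
  then have "AE \<omega> in M. \<forall>n. n \<ge> 1 \<longrightarrow> \<omega> \<notin> G n"
    by (subst AE_all_countable) auto
  moreover obtain k where "AE \<omega> in M. eventually (\<lambda>l. 2 * (\<Sum>j=1..l. long_dist k (\<lambda>e. Z e \<omega>) j) < l) sequentially"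
    using eventually_sum_long_dist_less by blast
  ultimately have "AE \<omega> in M. \<not> (\<forall>j>0. \<exists>i<j. Z (i, j) \<omega>)"
    using AE_space
  proof eventually_elim
    case (elim \<omega>)
    show ?case
    proof
      assume parents: "\<forall>j>0. \<exists>i<j. Z (i, j) \<omega>"
      obtain L where L: "\<And>l. L \<le> l \<Longrightarrow> 2 * (\<Sum>j=1..l. long_dist k (\<lambda>e. Z e \<omega>) j) < l"
        using elim(2) by (auto simp: eventually_sequentially)
      \<comment> \<open>The part \<open>2 * k\<close> serves \<open>l \<ge> L\<close>; the part
        \<open>L\<close> serves \<open>l < L\<close>, where a path without edges forces
        \<open>l = 0\<close> and any other has \<open>m \<ge> 1\<close>.\<close>
      define n where "n = Suc (2 * k + L)"
      have "\<exists>m. (0, l) \<in> {(i, j). i < j \<and> Z (i, j) \<omega>} ^^ m \<and> l \<le> n * m" for l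
      proof -
        obtain m where m: "(0, l) \<in> {(i, j). i < j \<and> Z (i, j) \<omega>} ^^ m"
            "l \<le> k * m + (\<Sum>j=1..l. long_dist k (\<lambda>e. Z e \<omega>) j)"
          using long_path[of "\<lambda>e. Z e \<omega>" l k] parents by blast
        have "l \<le> n * m"
        proof (cases "L \<le> l")
          case True
          then have "l \<le> 2 * k * m"
            using L[OF True] m(2) by simp
          also have "\<dots> \<le> n * m"
            unfolding n_def by (intro mult_right_mono) auto
          finally show ?thesis .
        next
          case False
          show ?thesis
          proof (cases m)
            case 0
            then show ?thesis
              using m by simp
          next
            case (Suc m')
            then show ?thesis
              using False by (simp add: n_def)
          qed
        qed
        with m show ?thesis
          by blast
      qed
      then have "\<omega> \<in> G n"
        using elim(3) by (simp add: G_def)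
      then show False
        using elim(1) by (simp add: n_def)
    qed
  qed
  moreover have "{\<omega> \<in> space M. \<forall>j>0. \<exists>i<j. Z (i, j) \<omega>} \<in> events"
    by measurable
  ultimately have "prob {\<omega> \<in> space M. \<forall>j>0. \<exists>i<j. Z (i, j) \<omega>} = 0"
    by (subst prob_Collect_eq_0)
  then show False
    using prob_all_parents by simp
qed

end

end

section \<open>Renewals for independent, identically distributed edge weights\<close>

text \<open>Confinement to the interval makes it visible that only edges inside it are read. As each
  of the \<open>m\<close> edges weighs at least \<open>d\<close>, the last clause bounds the weight
  of the path from below without a sum over its edges.\<close>

definition linked :: "real \<Rightarrow> real \<Rightarrow> int \<Rightarrow> int \<Rightarrow> (int \<times> int \<Rightarrow> real) \<Rightarrow> bool" where
  "linked d c a b g \<longleftrightarrow>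
    (\<exists>m. (a, b) \<in> {(i, j). a \<le> i \<and> i < j \<and> j \<le> b \<and> d \<le> g (i, j)} ^^ m \<and> c * (b - a) \<le> d * real m)"

text \<open>Formulated at the origin only; other points enter by translating the argument with
  \<open>shift_edge\<close>. The truncation at \<open>n\<close> makes the condition depend on the
  finitely many edges in \<open>window n\<close>.\<close>

definition renewal_upto :: "real \<Rightarrow> real \<Rightarrow> nat \<Rightarrow> (int \<times> int \<Rightarrow> real) \<Rightarrow> bool" where
  "renewal_upto d c n g \<longleftrightarrow>
    (\<forall>l\<in>{1..n}. linked d c 0 (int l) g \<and> linked d c (- int l) 0 g) \<and>
    (\<forall>j\<in>{1..n}. \<forall>l\<in>{1..n}. g (- int j, int l) < c * (real l + real j))"

definition window :: "nat \<Rightarrow> (int \<times> int) set" where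
  "window n = {(i, j). - int n \<le> i \<and> i < j \<and> j \<le> int n}"

definition shift_edge :: "int \<Rightarrow> int \<times> int \<Rightarrow> int \<times> int" where
  "shift_edge x = (\<lambda>(i, j). (i + x, j + x))"

section \<open>Locality, monotonicity and measurability of the truncated conditions\<close>

lemma linked_cong:
  assumes "\<And>i j. a \<le> i \<Longrightarrow> i < j \<Longrightarrow> j \<le> b \<Longrightarrow> g (i, j) = h (i, j)"
  shows "linked d c a b g \<longleftrightarrow> linked d c a b h"
proof -
  have "{(i, j). a \<le> i \<and> i < j \<and> j \<le> b \<and> d \<le> g (i, j)} = {(i, j). a \<le> i \<and> i < j \<and> j \<le> b \<and> d \<le> h (i, j)}"
    using assms by auto
  then show ?thesis
    by (simp add: linked_def)
qed

lemma renewal_upto_cong: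
  assumes "\<And>e. e \<in> window n \<Longrightarrow> g e = h e"
  shows "renewal_upto d c n g \<longleftrightarrow> renewal_upto d c n h"
proof -
  have "linked d c 0 (int l) g \<longleftrightarrow> linked d c 0 (int l) h"
      "linked d c (- int l) 0 g \<longleftrightarrow> linked d c (- int l) 0 h" if "l \<in> {1..n}" for l
    using that assms by (auto intro!: linked_cong simp: window_def)
  moreover have "g (- int j, int l) = h (- int j, int l)" if "j \<in> {1..n}" "l \<in> {1..n}" for j l
    using that by (intro assms) (auto simp: window_def)
  ultimately show ?thesis
    by (simp add: renewal_upto_def)
qed

lemma renewal_upto_mono: "renewal_upto d c n g" if "renewal_upto d c n' g" "n \<le> n'"
  using that by (auto simp: renewal_upto_def)

lemma all_renewal_upto_iff:
  "(\<forall>n. renewal_upto d c n g) \<longleftrightarrow>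
    (\<forall>l::nat\<ge>1. linked d c 0 (int l) g) \<and> (\<forall>l::nat\<ge>1. linked d c (- int l) 0 g) \<and>
    (\<forall>j::nat\<ge>1. \<forall>l::nat\<ge>1. g (- int j, int l) < c * (real l + real j))" (is "?L \<longleftrightarrow> ?R")
proof
  assume L: ?L
  show ?R
  proof (intro conjI allI impI)
    fix j l :: nat assume "1 \<le> j" "1 \<le> l"
    then show "g (- int j, int l) < c * (real l + real j)"
      using L[rule_format, of "max j l"] by (auto simp: renewal_upto_def)
  next
    fix l :: nat assume "1 \<le> l"
    then show "linked d c 0 (int l) g" "linked d c (- int l) 0 g"
      using L[rule_format, of l] by (auto simp: renewal_upto_def)
  qed
qed (auto simp: renewal_upto_def)

lemma linked_mono:
  assumes "linked d c a b g" "c' \<le> c" "a \<le> b"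
  shows "linked d c' a b g"
proof -
  have "c' * (b - a) \<le> c * (b - a)"
    using assms by (intro mult_right_mono) auto
  then show ?thesis
    using assms(1) unfolding linked_def by (meson order_trans)
qed

lemma pred_linked:
  assumes "{(i, j). a \<le> i \<and> i < j \<and> j \<le> b} \<subseteq> K"
  shows "Measurable.pred (Pi\<^sub>M K (\<lambda>_. borel)) (linked d c a b)"
proof -
  have "Measurable.pred (Pi\<^sub>M K (\<lambda>_. borel)) (\<lambda>g. (i, j) \<in> {(i, j). a \<le> i \<and> i < j \<and> j \<le> b \<and> d \<le> g (i, j)})" for i j
  \<comment> \<open>Edges inside the interval are coordinates of the product; for all others the
    membership is constantly false.\<close>
  proof (cases "a \<le> i \<and> i < j \<and> j \<le> b")
    case True
    then have [measurable]: "(\<lambda>g. g (i, j)) \<in> borel_measurable (Pi\<^sub>M K (\<lambda>_. borel :: real measure))"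
      using assms by (intro measurable_component_singleton) auto
    show ?thesis
      using True by simp measurable
  next
    case False
    then show ?thesis
      by simp
  qed
  note this [measurable]
  show ?thesis
    unfolding linked_def by measurable
qed

lemma pred_renewal_upto:
  assumes "window n \<subseteq> K"
  shows "Measurable.pred (Pi\<^sub>M K (\<lambda>_. borel)) (renewal_upto d c n)"
proof -
  have [measurable]: "Measurable.pred (Pi\<^sub>M K (\<lambda>_. borel)) (linked d c 0 (int l))"
      "Measurable.pred (Pi\<^sub>M K (\<lambda>_. borel)) (linked d c (- int l) 0)" if "l \<in> {1..n}" for l
    using that assms by (auto intro!: pred_linked simp: window_def)
  have [measurable]: "(\<lambda>g. g (- int j, int l)) \<in> borel_measurable (Pi\<^sub>M K (\<lambda>_. borel :: real measure))"
    if "j \<in> {1..n}" "l \<in> {1..n}" for j l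
    using that assms by (intro measurable_component_singleton) (auto simp: window_def)
  show ?thesis
    unfolding renewal_upto_def by measurable
qed

lemma linked_forward:
  assumes "(0, l) \<in> {(i, j). i < j \<and> d \<le> g (int i, int j)} ^^ m" "c * real l \<le> d * real m"
  shows "linked d c 0 (int l) g"
proof -
  obtain f where f: "f 0 = 0" "f m = l" "\<And>i. i < m \<Longrightarrow> f i < f (Suc i) \<and> d \<le> g (int (f i), int (f (Suc i)))"
    using assms(1) by (auto simp: relpow_fun_conv)
  \<comment> \<open>The vertices increase towards \<open>f m = l\<close>, so a downward induction
    keeps the path inside the interval.\<close>
  have "f i \<le> l" if "i \<le> m" for i
    using that f(2) by (induction i rule: inc_induct) (use f(3) in \<open>force dest: order_less_imp_le\<close>)+
  then have "(0, int l) \<in> {(i, j). 0 \<le> i \<and> i < j \<and> j \<le> int l \<and> d \<le> g (i, j)} ^^ m"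
    unfolding relpow_fun_conv using f by (intro exI[of _ "\<lambda>i. int (f i)"]) (auto simp: Suc_le_eq)
  then show ?thesis
    using assms(2) by (auto simp: linked_def)
qed

lemma linked_backward:
  assumes "(0, l) \<in> {(i, j). i < j \<and> d \<le> g (- int j, - int i)} ^^ m" "c * real l \<le> d * real m"
  shows "linked d c (- int l) 0 g"
proof -
  obtain f where f: "f 0 = 0" "f m = l" "\<And>i. i < m \<Longrightarrow> f i < f (Suc i) \<and> d \<le> g (- int (f (Suc i)), - int (f i))"
    using assms(1) by (auto simp: relpow_fun_conv)
  have le: "f i \<le> l" if "i \<le> m" for i
    using that f(2) by (induction i rule: inc_induct) (use f(3) in \<open>force dest: order_less_imp_le\<close>)+
  have "(- int l, 0) \<in> {(i, j). - int l \<le> i \<and> i < j \<and> j \<le> 0 \<and> d \<le> g (i, j)} ^^ m"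
    unfolding relpow_fun_conv
  \<comment> \<open>Reflection at the origin reverses the order of the vertices, so the path is
    traversed from its far end.\<close>
  proof (intro exI[of _ "\<lambda>i. - int (f (m - i))"] conjI allI impI)
    fix i assume "i < m"
    then show "(- int (f (m - i)), - int (f (m - Suc i)))
        \<in> {(i, j). - int l \<le> i \<and> i < j \<and> j \<le> 0 \<and> d \<le> g (i, j)}"
      using f(3)[of "m - Suc i"] le[of "m - i"] by (auto simp: Suc_diff_Suc)
  qed (use f in auto)
  then show ?thesis
    using assms(2) by (auto simp: linked_def)
qed

locale iid_edge_weights = prob_space M
  for M :: "'a measure" +
  fixes X :: "int \<times> int \<Rightarrow> 'a \<Rightarrow> real" and D :: "real measure"
  assumes indep: "indep_vars (\<lambda>_. borel) X edge_set"
    and law: "\<And>e. e \<in> edge_set \<Longrightarrow> distr M borel (X e) = D"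
    and square_integrable: "integrable D (\<lambda>x. x\<^sup>2)"
    and pos: "0 < measure D {0<..}"
begin

lemma X_measurable: "e \<in> edge_set \<Longrightarrow> X e \<in> borel_measurable M"
  using indep by (auto simp: indep_vars_def)

lemma prob_X:
  assumes "e \<in> edge_set" "{x. P x} \<in> sets borel"
  shows "prob {\<omega> \<in> space M. P (X e \<omega>)} = measure D {x. P x}"
proof -
  have "measure D {x. P x} = prob (X e -` {x. P x} \<inter> space M)"
    using assms X_measurable by (subst law[OF assms(1), symmetric]) (simp add: measure_distr)
  also have "X e -` {x. P x} \<inter> space M = {\<omega> \<in> space M. P (X e \<omega>)}"
    by auto
  finally show ?thesis ..
qed

lemma prob_space_D: "prob_space D" and sets_D [measurable_cong]: "sets D = sets borel"
proof -
  have e: "(0, 1) \<in> edge_set"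
    by (simp add: edge_set_def)
  show "prob_space D" "sets D = sets borel"
    unfolding law[OF e, symmetric] using X_measurable[OF e] by (auto intro: prob_space_distr)
qed

section \<open>Translates of the truncated renewal event\<close>

lemma shift_edge_in_edge_set: "e \<in> window n \<Longrightarrow> shift_edge x e \<in> edge_set"
  by (auto simp: window_def shift_edge_def edge_set_def)

lemma shift_edge_inject: "shift_edge x e = shift_edge x e' \<longleftrightarrow> e = e'"
  by (auto simp: shift_edge_def split: prod.splits)

definition renewals :: "real \<Rightarrow> real \<Rightarrow> int \<Rightarrow> nat \<Rightarrow> 'a set" where
  "renewals d c x n = {\<omega> \<in> space M. renewal_upto d c n (\<lambda>e. X (shift_edge x e) \<omega>)}"

text \<open>As a preimage under the vector of weights in the window, the event is measurable and its
  probability is determined by the joint law of that vector.\<close>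

lemma renewals_window:
  "renewals d c x n = (\<lambda>\<omega>. \<lambda>e\<in>window n. X (shift_edge x e) \<omega>) -` {g \<in> space (Pi\<^sub>M (window n) (\<lambda>_. borel)). renewal_upto d c n g} \<inter> space M"
  unfolding renewals_def by (auto simp: space_PiM cong: renewal_upto_cong)

lemma window_measurable:
  "(\<lambda>\<omega>. \<lambda>e\<in>window n. X (shift_edge x e) \<omega>) \<in> measurable M (Pi\<^sub>M (window n) (\<lambda>_. borel))"
  by (intro measurable_restrict X_measurable shift_edge_in_edge_set)

lemma renewals_sets: "renewals d c x n \<in> events"
  unfolding renewals_window
  by (intro measurable_sets[OF window_measurable] predE pred_renewal_upto) auto

text \<open>Whatever \<open>x\<close> is, the weights in the translated window have the same joint
  law, a product of copies of \<open>D\<close>.\<close>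

lemma prob_renewals_stationary: "prob (renewals d c x n) = prob (renewals d c 0 n)"
\<comment> \<open>For \<open>n = 0\<close> the window is empty, whereas the product characterisation
  of independence is applied to a nonempty index set.\<close>
proof (cases "n = 0")
  case True
  then show ?thesis
    by (simp add: renewals_def renewal_upto_def)
next
  case False
  have "(0, 1) \<in> window n"
    using False by (auto simp: window_def)
  then have ne: "window n \<noteq> {}"
    by blast
  have distr: "distr M (Pi\<^sub>M (window n) (\<lambda>_. borel)) (\<lambda>\<omega>. \<lambda>e\<in>window n. X (shift_edge x e) \<omega>) = Pi\<^sub>M (window n) (\<lambda>_. D)" for x
  proof -
    have "indep_vars (\<lambda>_. borel) (\<lambda>e. X (shift_edge x e)) (window n)"
      by (rule indep_vars_reindex[OF indep])
         (auto intro: shift_edge_in_edge_set inj_onI simp: shift_edge_inject)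
    then have "distr M (Pi\<^sub>M (window n) (\<lambda>_. borel)) (\<lambda>\<omega>. \<lambda>e\<in>window n. X (shift_edge x e) \<omega>)
        = Pi\<^sub>M (window n) (\<lambda>e. distr M borel (X (shift_edge x e)))"
      by (subst (asm) indep_vars_iff_distr_eq_PiM'[OF ne]) (auto intro: X_measurable shift_edge_in_edge_set)
    also have "\<dots> = Pi\<^sub>M (window n) (\<lambda>_. D)"
      by (intro PiM_cong law shift_edge_in_edge_set refl)
    finally show ?thesis .
  qed
  have "prob (renewals d c x n) =
      measure (Pi\<^sub>M (window n) (\<lambda>_. D)) {g \<in> space (Pi\<^sub>M (window n) (\<lambda>_. borel)). renewal_upto d c n g}" for x
    unfolding renewals_window distr[of x, symmetric]
    by (intro measure_distr[symmetric] window_measurable predE pred_renewal_upto) auto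
  then show ?thesis
    by simp
qed

text \<open>Windows of radius \<open>n\<close> around points at least \<open>2n + 1\<close> apart
  have no edge in common. The complements are taken because the event of interest is that all these
  renewals fail.\<close>

lemma indep_not_renewal_upto:
  "indep_events (\<lambda>k::nat. {\<omega> \<in> space M. \<not> renewal_upto d c n (\<lambda>e. X (shift_edge (x + int k * (2 * int n + 1)) e) \<omega>)}) UNIV"
proof (rule indep_events_groups[OF indep, where K = "\<lambda>k. shift_edge (x + int k * (2 * int n + 1)) ` window n"
      and Q = "\<lambda>k g. \<not> renewal_upto d c n (\<lambda>e. g (shift_edge (x + int k * (2 * int n + 1)) e))"])
  let ?y = "\<lambda>k::nat. x + int k * (2 * int n + 1)"
  have "k = k'" if "e \<in> window n" "e' \<in> window n" "shift_edge (?y k) e = shift_edge (?y k') e'" for k k' e e'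
  proof (rule ccontr)
    assume "k \<noteq> k'"
    have "?y k + (2 * int n + 1) \<le> ?y k'" if "k < k'" for k k'
      using mult_right_mono[of "int k + 1" "int k'" "2 * int n + 1"] that by (simp add: algebra_simps)
    then have "?y k + (2 * int n + 1) \<le> ?y k' \<or> ?y k' + (2 * int n + 1) \<le> ?y k"
      using \<open>k \<noteq> k'\<close> by (meson linorder_neqE_nat)
    \<comment> \<open>A common edge would have its left end in both windows, but their vertices lie
      in disjoint blocks of \<open>2n + 1\<close> integers.\<close>
    moreover have "fst e + ?y k = fst e' + ?y k'"
      using that(3) by (auto simp: shift_edge_def split: prod.splits)
    ultimately show False
      using that(1,2) by (auto simp: window_def)
  qed
  then show "disjoint_family_on (\<lambda>k. shift_edge (?y k) ` window n) UNIV"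
    unfolding disjoint_family_on_def by blast
  fix k
  have "(\<lambda>g. \<lambda>e\<in>window n. g (shift_edge (?y k) e)) \<in> measurable (Pi\<^sub>M (shift_edge (?y k) ` window n) (\<lambda>_. borel)) (Pi\<^sub>M (window n) (\<lambda>_. borel :: real measure))"
    by (intro measurable_restrict measurable_component_singleton) auto
  from measurable_compose[OF this pred_renewal_upto[OF order_refl]]
  have "Measurable.pred (Pi\<^sub>M (shift_edge (?y k) ` window n) (\<lambda>_. borel)) (\<lambda>g. renewal_upto d c n (\<lambda>e\<in>window n. g (shift_edge (?y k) e)))"
    by simp
  also have "(\<lambda>g. renewal_upto d c n (\<lambda>e\<in>window n. g (shift_edge (?y k) e))) = (\<lambda>g. renewal_upto d c n (\<lambda>e. g (shift_edge (?y k) e)))"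
    by (intro ext renewal_upto_cong) auto
  finally show "{g \<in> space (Pi\<^sub>M (shift_edge (?y k) ` window n) (\<lambda>_. borel)). \<not> renewal_upto d c n (\<lambda>e. g (shift_edge (?y k) e))}
      \<in> sets (Pi\<^sub>M (shift_edge (?y k) ` window n) (\<lambda>_. borel))"
    by (simp add: pred_def sets.sets_Collect_neg)
  fix \<omega>
  have "renewal_upto d c n (\<lambda>e. (\<lambda>e\<in>shift_edge (?y k) ` window n. X e \<omega>) (shift_edge (?y k) e))
      \<longleftrightarrow> renewal_upto d c n (\<lambda>e. X (shift_edge (?y k) e) \<omega>)"
    by (intro renewal_upto_cong) auto
  then show "(\<not> renewal_upto d c n (\<lambda>e. (\<lambda>e\<in>shift_edge (?y k) ` window n. X e \<omega>) (shift_edge (?y k) e)))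
      \<longleftrightarrow> (\<not> renewal_upto d c n (\<lambda>e. X (shift_edge (?y k) e) \<omega>))"
    by simp
qed (auto simp: shift_edge_in_edge_set)

lemma indep_renewals:
  "indep_events (\<lambda>k::nat. space M - renewals d c (x + int k * (2 * int n + 1)) n) UNIV"
proof -
  let ?y = "\<lambda>k::nat. x + int k * (2 * int n + 1)"
  have "space M - renewals d c (?y k) n = {\<omega> \<in> space M. \<not> renewal_upto d c n (\<lambda>e. X (shift_edge (?y k) e) \<omega>)}" for k
    by (auto simp: renewals_def)
  then show ?thesis
    using indep_not_renewal_upto by simp
qed

text \<open>
  Among \<open>m\<close> points with spacing \<open>2n + 1\<close> there is no renewal with probability at most
  \<open>(1 - \<rho>)\<^sup>m + m (r n - \<rho>)\<close>; let first \<open>n\<close> and then \<open>m\<close> tend to infinity.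
\<close>

lemma AE_infinite_renewals:
  assumes pos0: "0 < prob (\<Inter>n. renewals d c 0 n)"
  shows "AE \<omega> in M. infinite {x. \<forall>n. \<omega> \<in> renewals d c x n}"
proof -
  note renewals_sets [measurable]
  define \<rho> where "\<rho> = prob (\<Inter>n. renewals d c 0 n)"
  define r where "r = (\<lambda>n. prob (renewals d c 0 n))"
  define F where "F = (\<lambda>x. \<Inter>n. renewals d c x n)"
  have [measurable]: "F x \<in> events" for x
    unfolding F_def by measurable
  have dec: "decseq (renewals d c x)" for x
    by (auto simp: decseq_def renewals_def intro: renewal_upto_mono)
  have lim: "(\<lambda>n. prob (renewals d c x n)) \<longlonglongrightarrow> prob (F x)" for x
    unfolding F_def using dec by (intro finite_Lim_measure_decseq) auto
  have r: "r \<longlonglongrightarrow> \<rho>"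
    using lim[of 0] by (simp add: r_def \<rho>_def F_def)
  have F: "prob (F x) = \<rho>" for x
    using lim[of x] r unfolding prob_renewals_stationary[of d c x] r_def by (rule LIMSEQ_unique)
  have \<rho>_le: "\<rho> \<le> r n" for n
    unfolding \<rho>_def r_def by (intro finite_measure_mono) auto
  have bound: "prob {\<omega> \<in> space M. \<forall>x\<ge>K. \<omega> \<notin> F x} \<le> (1 - \<rho>) ^ m + real m * (r n - \<rho>)"
    if "m \<ge> 1" for K m n
  proof -
    define y where "y = (\<lambda>k::nat. K + int k * (2 * int n + 1))"
    let ?R = "\<lambda>k. renewals d c (y k) n"
    have y: "K \<le> y k" for k
      by (simp add: y_def)
    have m: "{..<m} \<noteq> {}"
      using that by (metis empty_iff lessThan_iff less_le_trans zero_less_one)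
    have "prob (\<Inter>k<m. space M - ?R k) = (\<Prod>k<m. prob (space M - ?R k))"
      using conjunct2[OF indep_renewals[of d c K n, unfolded indep_events_def]] m
      by (simp add: y_def)
    also have "\<dots> = (\<Prod>k<m. 1 - r n)"
      by (intro prod.cong refl) (simp add: prob_compl prob_renewals_stationary[of d c "y _"] r_def)
    also have "\<dots> \<le> (1 - \<rho>) ^ m"
      using \<rho>_le[of n] by (simp add: power_mono r_def)
    finally have 1: "prob (\<Inter>k<m. space M - ?R k) \<le> (1 - \<rho>) ^ m" .
    have "prob (\<Union>k<m. ?R k - F (y k)) \<le> (\<Sum>k<m. prob (?R k - F (y k)))"
      by (intro finite_measure_subadditive_finite) auto
    also have "\<dots> = (\<Sum>k<m. r n - \<rho>)"
    proof (intro sum.cong refl)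
      fix k
      have "F (y k) \<subseteq> ?R k"
        by (auto simp: F_def)
      then show "prob (?R k - F (y k)) = r n - \<rho>"
        by (simp add: finite_measure_Diff prob_renewals_stationary[of d c "y _"] r_def F)
    qed
    finally have 2: "prob (\<Union>k<m. ?R k - F (y k)) \<le> real m * (r n - \<rho>)"
      by simp
    \<comment> \<open>Without a renewal point from \<open>K\<close> on, either all \<open>m\<close>
      truncated renewals fail or one of them occurs without extending to all radii.\<close>
    have "prob {\<omega> \<in> space M. \<forall>x\<ge>K. \<omega> \<notin> F x}
        \<le> prob ((\<Inter>k<m. space M - ?R k) \<union> (\<Union>k<m. ?R k - F (y k)))"
      using m y by (intro finite_measure_mono Un_least sets.Un sets.finite_INT) auto
    also have "\<dots> \<le> prob (\<Inter>k<m. space M - ?R k) + prob (\<Union>k<m. ?R k - F (y k))"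
      using m by (intro measure_Un_le sets.finite_INT) auto
    finally show ?thesis
      using 1 2 by simp
  qed
  have "prob {\<omega> \<in> space M. \<forall>x\<ge>K. \<omega> \<notin> F x} = 0" for K
  proof -
    have le: "prob {\<omega> \<in> space M. \<forall>x\<ge>K. \<omega> \<notin> F x} \<le> (1 - \<rho>) ^ m" if "m \<ge> 1" for m
    proof -
      have "(\<lambda>n. (1 - \<rho>) ^ m + real m * (r n - \<rho>)) \<longlonglongrightarrow> (1 - \<rho>) ^ m + real m * (\<rho> - \<rho>)"
        by (intro tendsto_intros r)
      then show ?thesis
        using bound[OF that] by (intro LIMSEQ_le_const[of _ "(1 - \<rho>) ^ m"]) auto
    qed
    have "\<rho> \<le> 1"
      by (simp add: \<rho>_def)
    then have "(\<lambda>m. (1 - \<rho>) ^ m) \<longlonglongrightarrow> 0"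
      using pos0 by (intro LIMSEQ_realpow_zero) (auto simp: \<rho>_def)
    then have "prob {\<omega> \<in> space M. \<forall>x\<ge>K. \<omega> \<notin> F x} \<le> 0"
      using le by (intro LIMSEQ_le_const) auto
    then show ?thesis
      by (simp add: measure_le_0_iff)
  qed
  then have "AE \<omega> in M. \<not> (\<forall>x\<ge>K. \<omega> \<notin> F x)" for K
    by (subst prob_Collect_eq_0[symmetric]) auto
  then have "AE \<omega> in M. \<forall>K. \<exists>x\<ge>K. \<omega> \<in> F x"
    by (subst AE_all_countable) auto
  then show ?thesis
  proof eventually_elim
    case (elim \<omega>)
    show ?case
    proof
      assume fin: "finite {x. \<forall>n. \<omega> \<in> renewals d c x n}"
      obtain x where x: "Max {x. \<forall>n. \<omega> \<in> renewals d c x n} + 1 \<le> x" "\<omega> \<in> F x"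
        using elim by blast
      then have "x \<le> Max {x. \<forall>n. \<omega> \<in> renewals d c x n}"
        using fin by (intro Max_ge) (auto simp: F_def)
      with x(1) show False
        by simp
    qed
  qed
qed

section \<open>Heavy edges jumping over a point\<close>

lemma prob_X_less_lower_bound:
  assumes "finite J" "J \<subseteq> edge_set"
  shows "1 - real (card J) * measure D {t..} \<le> prob {\<omega> \<in> space M. \<forall>e\<in>J. X e \<omega> < t}"
proof -
  note X_measurable [measurable]
  have sets: "{\<omega> \<in> space M. t \<le> X e \<omega>} \<in> events" if "e \<in> J" for e
    by measurable (use that assms in auto)
  have "prob (\<Union>e\<in>J. {\<omega> \<in> space M. t \<le> X e \<omega>}) \<le> (\<Sum>e\<in>J. prob {\<omega> \<in> space M. t \<le> X e \<omega>})"
    using assms sets by (intro finite_measure_subadditive_finite) auto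
  also have "\<dots> = (\<Sum>e\<in>J. measure D {x. t \<le> x})"
    using assms by (intro sum.cong prob_X refl) auto
  also have "\<dots> = real (card J) * measure D {t..}"
    by (simp add: atLeast_def)
  finally have "1 - real (card J) * measure D {t..} \<le> 1 - prob (\<Union>e\<in>J. {\<omega> \<in> space M. t \<le> X e \<omega>})"
    by simp
  also have "\<dots> = prob (space M - (\<Union>e\<in>J. {\<omega> \<in> space M. t \<le> X e \<omega>}))"
    using assms sets by (subst prob_compl) auto
  also have "space M - (\<Union>e\<in>J. {\<omega> \<in> space M. t \<le> X e \<omega>}) = {\<omega> \<in> space M. \<forall>e\<in>J. X e \<omega> < t}"
    by (auto simp: not_le)
  finally show ?thesis .
qed

text \<open>Complements the union bound of \<open>prob_X_less_lower_bound\<close>, which may be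
  negative: here independence yields strict positivity.\<close>

lemma prob_X_less_pos:
  assumes "finite J" "J \<subseteq> edge_set" "0 < measure D {..<t}"
  shows "0 < prob {\<omega> \<in> space M. \<forall>e\<in>J. X e \<omega> < t}"
proof (cases "J = {}")
  case False
  have "{\<omega> \<in> space M. \<forall>e\<in>J. X e \<omega> < t} = (\<Inter>e\<in>J. X e -` {..<t} \<inter> space M)"
    using False by auto
  also have "prob \<dots> = (\<Prod>e\<in>J. prob (X e -` {..<t} \<inter> space M))"
    using False assms by (intro indep_varsD[OF indep]) auto
  also have "\<dots> = (\<Prod>e\<in>J. measure D {..<t})"
  proof (intro prod.cong refl)
    fix e assume e: "e \<in> J"
    have "X e -` {..<t} \<inter> space M = {\<omega> \<in> space M. X e \<omega> < t}"
      by auto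
    then show "prob (X e -` {..<t} \<inter> space M) = measure D {..<t}"
      using prob_X[of e "\<lambda>x. x < t"] e assms(2) by (auto simp: lessThan_def)
  qed
  finally show ?thesis
    using assms by simp
qed (simp add: prob_space)

text \<open>If the term with index \<open>N\<close> is present, then \<open>N + 1\<close> terms of
  size at most \<open>N + 2 \<le> y\<close> sum to at most \<open>y\<^sup>2\<close>; if it vanishes,
  the previous bound persists.\<close>

lemma sum_tail_le:
  fixes y :: real
  shows "(\<Sum>n<N. real (n + 1) * of_bool (real (n + 2) \<le> y)) \<le> y\<^sup>2"
proof (induction N)
  case (Suc N)
  show ?case
  proof (cases "real (N + 2) \<le> y")
    case True
    have "(\<Sum>n<Suc N. real (n + 1) * of_bool (real (n + 2) \<le> y)) \<le> (\<Sum>n<Suc N. real (N + 2))"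
      by (intro sum_mono) (auto simp: of_bool_def)
    also have "\<dots> = real (Suc N) * real (N + 2)"
      by simp
    also have "\<dots> \<le> y * y"
      using True by (intro mult_mono) auto
    finally show ?thesis
      by (simp add: power2_eq_square)
  qed (use Suc in simp)
qed simp

text \<open>Here the second moment enters: integrating \<open>sum_tail_le\<close> at
  \<open>y = x / c\<close> bounds all partial sums. The factor \<open>n + 1\<close> counts the edges
  of length \<open>n + 2\<close> that jump over a given point.\<close>

lemma summable_tail:
  assumes "0 < c"
  shows "summable (\<lambda>n. real (n + 1) * measure D {c * real (n + 2)..})"
proof (rule summableI_nonneg_bounded)
  interpret D: prob_space D
    by (rule prob_space_D)
  fix N :: nat
  have "(\<Sum>n<N. real (n + 1) * measure D {c * real (n + 2)..})
      = (\<Sum>n<N. \<integral>x. real (n + 1) * indicator {c * real (n + 2)..} x \<partial>D)"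
    by (intro sum.cong refl) (simp add: sets_D)
  also have "\<dots> = (\<integral>x. (\<Sum>n<N. real (n + 1) * indicator {c * real (n + 2)..} x) \<partial>D)"
    by (intro Bochner_Integration.integral_sum[symmetric] integrable_mult_right) (auto simp: sets_D D.emeasure_eq_measure)
  also have "\<dots> \<le> (\<integral>x. x\<^sup>2 / c\<^sup>2 \<partial>D)"
  proof (intro integral_mono integrable_divide square_integrable Bochner_Integration.integrable_sum integrable_mult_right)
    fix x
    have "indicator {c * real (n + 2)..} x = (of_bool (real (n + 2) \<le> x / c) :: real)" for n
      using assms by (auto simp: indicator_def field_simps)
    then show "(\<Sum>n<N. real (n + 1) * indicator {c * real (n + 2)..} x) \<le> x\<^sup>2 / c\<^sup>2"
      using sum_tail_le[where y = "x / c" and N = N] by (simp add: power_divide)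
  qed (auto simp: sets_D D.emeasure_eq_measure)
  finally show "(\<Sum>n<N. real (n + 1) * measure D {c * real (n + 2)..}) \<le> (\<integral>x. x\<^sup>2 / c\<^sup>2 \<partial>D)" .
qed simp

text \<open>The jumping edges are grouped by length. The groups are independent, and the union bound
  makes the failure probabilities summable by \<open>summable_tail\<close>. Since a jumping edge has
  length at least 2, the assumption on \<open>2 * c\<close> makes every single group succeed with
  positive probability.\<close>

lemma prob_crossing_pos:
  assumes c: "0 < c" and small: "0 < measure D {..<2 * c}"
  shows "0 < prob {\<omega> \<in> space M. \<forall>j::nat\<ge>1. \<forall>l::nat\<ge>1. X (- int j, int l) \<omega> < c * (real l + real j)}"
proof -
  interpret D: prob_space D
    by (rule prob_space_D)
  \<comment> \<open>\<open>J n\<close> consists of the \<open>n + 1\<close> edges of length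
    \<open>n + 2\<close> that have 0 strictly between their ends.\<close>
  define J where "J = (\<lambda>n. (\<lambda>j. (- int (Suc j), int (Suc (n - j)))) ` {..n})"
  define A where "A = (\<lambda>n. {\<omega> \<in> space M. \<forall>e\<in>J n. X e \<omega> < c * real (n + 2)})"
  have J: "finite (J n)" "J n \<subseteq> edge_set" "card (J n) = n + 1" for n
    by (auto simp: J_def edge_set_def card_image inj_on_def)
  have "indep_events A UNIV"
    unfolding A_def
  proof (rule indep_events_groups[OF indep, where K = J and Q = "\<lambda>n g. \<forall>e\<in>J n. g e < c * real (n + 2)"])
    show "disjoint_family_on J UNIV"
      by (auto simp: disjoint_family_on_def J_def)
    fix n
    show "{g \<in> space (Pi\<^sub>M (J n) (\<lambda>_. borel)). \<forall>e\<in>J n. g e < c * real (n + 2)} \<in> sets (Pi\<^sub>M (J n) (\<lambda>_. borel))"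
      using J(1)[of n] by measurable
  qed (use J in auto)
  moreover have "0 < prob (A n)" for n
  proof -
    have "2 * c \<le> c * real (n + 2)"
      using c by (simp add: algebra_simps)
    then have "measure D {..<2 * c} \<le> measure D {..<c * real (n + 2)}"
      by (intro D.finite_measure_mono) (auto simp: sets_D)
    then show ?thesis
      unfolding A_def using J small by (intro prob_X_less_pos) auto
  qed
  moreover have "summable (\<lambda>n. 1 - prob (A n))"
  proof (rule summable_comparison_test[OF _ summable_tail[OF c]], intro exI allI impI)
    fix n
    show "norm (1 - prob (A n)) \<le> real (n + 1) * measure D {c * real (n + 2)..}"
      using prob_X_less_lower_bound[of "J n" "c * real (n + 2)"] J by (simp add: A_def)
  qed
  ultimately have "0 < prob (\<Inter>n. A n)"
    by (intro prob_INT_pos)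
  also have "(\<Inter>n. A n) = {\<omega> \<in> space M. \<forall>j::nat\<ge>1. \<forall>l::nat\<ge>1. X (- int j, int l) \<omega> < c * (real l + real j)}"
  proof (intro equalityI subsetI)
    fix \<omega> assume \<omega>: "\<omega> \<in> (\<Inter>n. A n)"
    have "X (- int j, int l) \<omega> < c * (real l + real j)" if "1 \<le> j" "1 \<le> l" for j l
    proof -
      have "\<omega> \<in> A (j + l - 2)"
        using \<omega> by blast
      then have "\<forall>e\<in>J (j + l - 2). X e \<omega> < c * real (j + l - 2 + 2)"
        by (simp add: A_def)
      moreover have "(- int j, int l) \<in> J (j + l - 2)"
        unfolding J_def using that by (intro image_eqI[where x = "j - 1"]) auto
      moreover have "real (j + l - 2 + 2) = real l + real j"
        using that by simp
      ultimately show ?thesis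
        by metis
    qed
    then show "\<omega> \<in> {\<omega> \<in> space M. \<forall>j::nat\<ge>1. \<forall>l::nat\<ge>1. X (- int j, int l) \<omega> < c * (real l + real j)}"
      using \<omega> by (auto simp: A_def)
  next
    fix \<omega>
    assume \<omega>: "\<omega> \<in> {\<omega> \<in> space M. \<forall>j::nat\<ge>1. \<forall>l::nat\<ge>1. X (- int j, int l) \<omega> < c * (real l + real j)}"
    have "X (- int (Suc j), int (Suc (n - j))) \<omega> < c * real (n + 2)" if "j \<le> n" for j n
    proof -
      have "X (- int (Suc j), int (Suc (n - j))) \<omega> < c * (real (Suc (n - j)) + real (Suc j))"
        using \<omega> by (simp del: of_nat_Suc)
      also have "real (Suc (n - j)) + real (Suc j) = real (n + 2)"
        using that by (simp add: of_nat_diff)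
      finally show ?thesis .
    qed
    then show "\<omega> \<in> (\<Inter>n. A n)"
      using \<omega> by (auto simp: A_def J_def)
  qed
  finally show ?thesis .
qed

lemma prob_renewals_pos:
  assumes c: "0 < c" and small: "0 < measure D {..<2 * c}"
    and forward: "0 < prob {\<omega> \<in> space M. \<forall>l::nat\<ge>1. linked d c 0 (int l) (\<lambda>e. X e \<omega>)}"
    and backward: "0 < prob {\<omega> \<in> space M. \<forall>l::nat\<ge>1. linked d c (- int l) 0 (\<lambda>e. X e \<omega>)}"
  shows "0 < prob (\<Inter>n. renewals d c 0 n)"
proof -
  define Q where "Q = (\<lambda>k::nat. \<lambda>g.
      if k = 0 then \<forall>l::nat\<ge>1. linked d c 0 (int l) g
      else if k = 1 then \<forall>l::nat\<ge>1. linked d c (- int l) 0 g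
      else \<forall>j::nat\<ge>1. \<forall>l::nat\<ge>1. g (- int j, int l) < c * (real l + real j))"
  \<comment> \<open>An edge with 0 as an end belongs to one of the two sides, so the three sets
    partition \<open>edge_set\<close> and independence multiplies the three probabilities.\<close>
  define K where "K = (\<lambda>k::nat.
      if k = 0 then {(i, j). 0 \<le> i \<and> i < j}
      else if k = 1 then {(i, j). i < j \<and> j \<le> 0}
      else {(i, j). i < 0 \<and> 0 < j} :: (int \<times> int) set)"
  define A where "A = (\<lambda>k. {\<omega> \<in> space M. Q k (\<lambda>e. X e \<omega>)})"
  have "indep_events A {0, 1, 2}"
    unfolding A_def
  proof (rule indep_events_groups[OF indep, where K = K and Q = Q])
    show "disjoint_family_on K {0, 1, 2}"
      by (auto simp: disjoint_family_on_def K_def)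
    fix k :: nat assume k: "k \<in> {0, 1, 2}"
    show "K k \<subseteq> edge_set"
      by (auto simp: K_def edge_set_def)
    have "Measurable.pred (Pi\<^sub>M (K k) (\<lambda>_. borel)) (Q k)"
    proof -
      consider "k = 0" | "k = 1" | "k = 2"
        using k by auto
      then show ?thesis
      proof cases
        case 1
        have [measurable]: "Measurable.pred (Pi\<^sub>M (K k) (\<lambda>_. borel)) (linked d c 0 (int l))" for l
          by (intro pred_linked) (auto simp: 1 K_def)
        have "Q k = (\<lambda>g. \<forall>l::nat\<ge>1. linked d c 0 (int l) g)"
          by (simp add: 1 Q_def)
        then show ?thesis
          by simp
      next
        case 2
        have [measurable]: "Measurable.pred (Pi\<^sub>M (K k) (\<lambda>_. borel)) (linked d c (- int l) 0)" for l
          by (intro pred_linked) (auto simp: 2 K_def)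
        have "Q k = (\<lambda>g. \<forall>l::nat\<ge>1. linked d c (- int l) 0 g)"
          by (simp add: 2 Q_def)
        then show ?thesis
          by simp
      next
        case 3
        have [measurable]: "(\<lambda>g. g (- int j, int l)) \<in> borel_measurable (Pi\<^sub>M (K k) (\<lambda>_. borel :: real measure))"
          if "1 \<le> j" "1 \<le> l" for j l
          using that by (intro measurable_component_singleton) (auto simp: 3 K_def)
        have "Measurable.pred (Pi\<^sub>M (K k) (\<lambda>_. borel)) (\<lambda>g. \<forall>j\<in>{1::nat..}. \<forall>l\<in>{1::nat..}. g (- int j, int l) < c * (real l + real j))"
          by measurable (auto simp: 3 K_def)
        moreover have "Q k = (\<lambda>g. \<forall>j\<in>{1::nat..}. \<forall>l\<in>{1::nat..}. g (- int j, int l) < c * (real l + real j))"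
          unfolding 3 Q_def by (intro ext) auto
        ultimately show ?thesis
          by metis
      qed
    qed
    then show "{g \<in> space (Pi\<^sub>M (K k) (\<lambda>_. borel)). Q k g} \<in> sets (Pi\<^sub>M (K k) (\<lambda>_. borel))"
      by (simp add: pred_def)
    fix \<omega>
    have "linked d c 0 (int l) (\<lambda>e\<in>K k. X e \<omega>) \<longleftrightarrow> linked d c 0 (int l) (\<lambda>e. X e \<omega>)" if "k = 0" for l
      using that by (intro linked_cong) (auto simp: K_def)
    moreover have "linked d c (- int l) 0 (\<lambda>e\<in>K k. X e \<omega>) \<longleftrightarrow> linked d c (- int l) 0 (\<lambda>e. X e \<omega>)" if "k = 1" for l
      using that by (intro linked_cong) (auto simp: K_def)
    moreover have "(\<lambda>e\<in>K k. X e \<omega>) (- int j, int l) = X (- int j, int l) \<omega>" if "k = 2" "1 \<le> j" "1 \<le> l" for j l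
      using that by (auto simp: K_def)
    ultimately show "Q k (\<lambda>e\<in>K k. X e \<omega>) \<longleftrightarrow> Q k (\<lambda>e. X e \<omega>)"
      using k by (auto simp: Q_def simp del: restrict_apply)
  qed
  then have "\<forall>J\<subseteq>{0, 1, 2}. J \<noteq> {} \<longrightarrow> finite J \<longrightarrow> prob (\<Inter>k\<in>J. A k) = (\<Prod>k\<in>J. prob (A k))"
    unfolding indep_events_def by (rule conjunct2)
  from this[rule_format, of "{0, 1, 2}"]
  have "prob (\<Inter>k\<in>{0, 1, 2}. A k) = (\<Prod>k\<in>{0, 1, 2}. prob (A k))"
    by simp
  moreover have "0 < (\<Prod>k\<in>{0, 1, 2}. prob (A k))"
    using forward backward prob_crossing_pos[OF c small] by (simp add: A_def Q_def)
  moreover have "(\<Inter>k\<in>{0, 1, 2}. A k) = (\<Inter>n. renewals d c 0 n)"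
  proof -
    have "(\<Inter>n. renewals d c 0 n) = {\<omega> \<in> space M. \<forall>n. renewal_upto d c n (\<lambda>e. X e \<omega>)}"
      by (auto simp: renewals_def shift_edge_def)
    then show ?thesis
      unfolding all_renewal_upto_iff by (auto simp: A_def Q_def)
  qed
  ultimately show ?thesis
    by simp
qed

section \<open>Linearly long paths of good edges\<close>

lemma sets_linked:
  "{\<omega> \<in> space M. \<forall>l::nat\<ge>1. linked d c (u l) (w l) (\<lambda>e. X e \<omega>)} \<in> events"
proof -
  have "(\<lambda>\<omega>. \<lambda>e\<in>edge_set. X e \<omega>) \<in> measurable M (Pi\<^sub>M edge_set (\<lambda>_. borel))"
    by (intro measurable_restrict X_measurable)
  moreover have "Measurable.pred (Pi\<^sub>M edge_set (\<lambda>_. borel)) (linked d c (u l) (w l))" for l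
    by (intro pred_linked) (auto simp: edge_set_def)
  ultimately have "Measurable.pred M (\<lambda>\<omega>. linked d c (u l) (w l) (\<lambda>e\<in>edge_set. X e \<omega>))" for l
    by (rule measurable_compose)
  moreover have "linked d c (u l) (w l) (\<lambda>e\<in>edge_set. X e \<omega>) \<longleftrightarrow> linked d c (u l) (w l) (\<lambda>e. X e \<omega>)" for l \<omega>
    by (intro linked_cong) (auto simp: edge_set_def)
  ultimately have [measurable]: "Measurable.pred M (\<lambda>\<omega>. linked d c (u l) (w l) (\<lambda>e. X e \<omega>))" for l
    by simp
  show ?thesis
    by measurable
qed

text \<open>The edges of weight at least \<open>d\<close> on a half-line form a random graph as in
  \<open>linear_paths\<close>, with \<open>q = measure D {d..}\<close>. A path of \<open>m\<close>
  such edges with \<open>l \<le> n * m\<close> weighs at least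
  \<open>d * m \<ge> (d / n) * l\<close>.\<close>

lemma linked_pos:
  assumes d: "0 < d" "0 < measure D {d..}"
  shows "\<exists>n\<ge>1. 0 < prob {\<omega> \<in> space M. \<forall>l::nat\<ge>1. linked d (d / real n) 0 (int l) (\<lambda>e. X e \<omega>)}"
    and "\<exists>n\<ge>1. 0 < prob {\<omega> \<in> space M. \<forall>l::nat\<ge>1. linked d (d / real n) (- int l) 0 (\<lambda>e. X e \<omega>)}"
proof -
  interpret D: prob_space D
    by (rule prob_space_D)
  \<comment> \<open>The injection \<open>h\<close> places the graph on the natural numbers on either
    half-line; for the left one it is a reflection, which swaps the ends of each edge.\<close>
  have main: "\<exists>n\<ge>1. 0 < prob {\<omega> \<in> space M. \<forall>l. \<exists>m. (0, l) \<in> {(i, j). i < j \<and> d \<le> X (h (i, j)) \<omega>} ^^ m \<and> l \<le> n * m}"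
    if h: "inj h" "\<And>i j. i < j \<Longrightarrow> h (i, j) \<in> edge_set" for h :: "nat \<times> nat \<Rightarrow> int \<times> int"
  proof (rule linear_paths[where q = "measure D {d..}"])
    have "indep_vars (\<lambda>_. borel) (\<lambda>e. X (h e)) {(i, j). i < j}"
      using h by (intro indep_vars_reindex[OF indep]) (auto intro: inj_on_subset)
    then show "indep_vars (\<lambda>_. count_space UNIV) (\<lambda>e \<omega>. d \<le> X (h e) \<omega>) {(i, j). i < j}"
      by (rule indep_vars_compose2[where Y = "\<lambda>_ x. d \<le> x"]) measurable
    show "prob {\<omega> \<in> space M. d \<le> X (h (i, j)) \<omega>} = measure D {d..}" if "i < j" for i j
      using prob_X[OF h(2)[OF that], of "\<lambda>x. d \<le> x"] by (simp add: atLeast_def)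
  qed (use d in auto)
  have scale: "d / real n * real l \<le> d * real m" if "l \<le> n * m" "n \<ge> 1" for l m n
  proof -
    have "real l \<le> real n * real m"
      using that(1) by (simp flip: of_nat_mult)
    then show ?thesis
      using that(2) d by (simp add: field_simps)
  qed
  have "inj (\<lambda>(i, j). (int i, int j))"
    by (auto simp: inj_on_def)
  then obtain n where n: "n \<ge> 1" "0 < prob {\<omega> \<in> space M. \<forall>l. \<exists>m. (0, l) \<in> {(i, j). i < j \<and> d \<le> X (int i, int j) \<omega>} ^^ m \<and> l \<le> n * m}"
    using main[of "\<lambda>(i, j). (int i, int j)"] by (auto simp: edge_set_def)
  note n(2)
  also have "prob {\<omega> \<in> space M. \<forall>l. \<exists>m. (0, l) \<in> {(i, j). i < j \<and> d \<le> X (int i, int j) \<omega>} ^^ m \<and> l \<le> n * m}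
      \<le> prob {\<omega> \<in> space M. \<forall>l::nat\<ge>1. linked d (d / real n) 0 (int l) (\<lambda>e. X e \<omega>)}"
  proof (intro finite_measure_mono sets_linked Collect_mono impI conjI allI; elim conjE)
    fix \<omega> and l :: nat
    assume "\<forall>l. \<exists>m. (0, l) \<in> {(i, j). i < j \<and> d \<le> X (int i, int j) \<omega>} ^^ m \<and> l \<le> n * m"
    then obtain m where "(0, l) \<in> {(i, j). i < j \<and> d \<le> X (int i, int j) \<omega>} ^^ m" "l \<le> n * m"
      by blast
    then show "linked d (d / real n) 0 (int l) (\<lambda>e. X e \<omega>)"
      using scale n(1) by (intro linked_forward) auto
  qed
  finally show "\<exists>n\<ge>1. 0 < prob {\<omega> \<in> space M. \<forall>l::nat\<ge>1. linked d (d / real n) 0 (int l) (\<lambda>e. X e \<omega>)}"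
    using n(1) by blast
  have "inj (\<lambda>(i, j). (- int j, - int i))"
    by (auto simp: inj_on_def)
  then obtain n where n: "n \<ge> 1" "0 < prob {\<omega> \<in> space M. \<forall>l. \<exists>m. (0, l) \<in> {(i, j). i < j \<and> d \<le> X (- int j, - int i) \<omega>} ^^ m \<and> l \<le> n * m}"
    using main[of "\<lambda>(i, j). (- int j, - int i)"] by (auto simp: edge_set_def)
  note n(2)
  also have "prob {\<omega> \<in> space M. \<forall>l. \<exists>m. (0, l) \<in> {(i, j). i < j \<and> d \<le> X (- int j, - int i) \<omega>} ^^ m \<and> l \<le> n * m}
      \<le> prob {\<omega> \<in> space M. \<forall>l::nat\<ge>1. linked d (d / real n) (- int l) 0 (\<lambda>e. X e \<omega>)}"
  proof (intro finite_measure_mono sets_linked Collect_mono impI conjI allI; elim conjE)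
    fix \<omega> and l :: nat
    assume "\<forall>l. \<exists>m. (0, l) \<in> {(i, j). i < j \<and> d \<le> X (- int j, - int i) \<omega>} ^^ m \<and> l \<le> n * m"
    then obtain m where "(0, l) \<in> {(i, j). i < j \<and> d \<le> X (- int j, - int i) \<omega>} ^^ m" "l \<le> n * m"
      by blast
    then show "linked d (d / real n) (- int l) 0 (\<lambda>e. X e \<omega>)"
      using scale n(1) by (intro linked_backward) auto
  qed
  finally show "\<exists>n\<ge>1. 0 < prob {\<omega> \<in> space M. \<forall>l::nat\<ge>1. linked d (d / real n) (- int l) 0 (\<lambda>e. X e \<omega>)}"
    using n(1) by blast
qed

text \<open>Almost surely every weight is at least \<open>a\<close>, so the path through all
  consecutive integers has \<open>l\<close> edges of weight at least \<open>a\<close> and reaches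
  slope \<open>a\<close>.\<close>

lemma prob_linked_eq_1:
  assumes a: "measure D {..<a} = 0"
  shows "prob {\<omega> \<in> space M. \<forall>l::nat\<ge>1. linked a a 0 (int l) (\<lambda>e. X e \<omega>)} = 1"
    and "prob {\<omega> \<in> space M. \<forall>l::nat\<ge>1. linked a a (- int l) 0 (\<lambda>e. X e \<omega>)} = 1"
proof -
  note X_measurable [measurable]
  have "AE \<omega> in M. \<not> X e \<omega> < a" if e: "e \<in> edge_set" for e
    using prob_X[OF e, of "\<lambda>x. x < a"] a e
    by (subst prob_Collect_eq_0[symmetric]) (auto simp: lessThan_def)
  then have ae: "AE \<omega> in M. \<forall>e\<in>edge_set. \<not> X e \<omega> < a"
    by (subst AE_ball_countable) auto
  have path: "(0, l) \<in> R ^^ l" if "\<And>i. (i, Suc i) \<in> R" for l R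
    unfolding relpow_fun_conv using that by (intro exI[of _ "\<lambda>i. i"]) auto
  have "AE \<omega> in M. \<forall>l::nat\<ge>1. linked a a 0 (int l) (\<lambda>e. X e \<omega>)"
    using ae by eventually_elim
      (auto intro!: linked_forward[OF path] simp: edge_set_def not_less)
  then show "prob {\<omega> \<in> space M. \<forall>l::nat\<ge>1. linked a a 0 (int l) (\<lambda>e. X e \<omega>)} = 1"
    by (subst prob_Collect_eq_1[OF sets_linked])
  have "AE \<omega> in M. \<forall>l::nat\<ge>1. linked a a (- int l) 0 (\<lambda>e. X e \<omega>)"
    using ae by eventually_elim
      (auto intro!: linked_backward[OF path] simp: edge_set_def not_less)
  then show "prob {\<omega> \<in> space M. \<forall>l::nat\<ge>1. linked a a (- int l) 0 (\<lambda>e. X e \<omega>)} = 1"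
    by (subst prob_Collect_eq_1[OF sets_linked])
qed

theorem ex_AE_infinite_renewals:
  "\<exists>d>0. \<exists>c>0. AE \<omega> in M. infinite {x. \<forall>n. \<omega> \<in> renewals d c x n}"
proof -
  interpret D: prob_space D
    by (rule prob_space_D)
  have "\<exists>d>0. \<exists>c>0. 0 < prob (\<Inter>n. renewals d c 0 n)"
  \<comment> \<open>The first case includes every law with an atom at 0, hence every graph in which
    edges are absent with positive probability.\<close>
  proof (cases "\<forall>\<epsilon>>0. 0 < measure D {..<\<epsilon>}")
    case True
    have "(\<lambda>n. measure D {1 / real (Suc n)..}) \<longlonglongrightarrow> measure D (\<Union>n. {1 / real (Suc n)..})"
      by (intro D.finite_Lim_measure_incseq) (auto simp: sets_D incseq_def field_simps intro: order_trans)
    also have "(\<Union>n. {1 / real (Suc n)..}) = {0<..}"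
    proof (intro equalityI subsetI)
      fix x :: real assume "x \<in> {0<..}"
      then obtain n where "inverse (real (Suc n)) < x"
        using reals_Archimedean by auto
      then show "x \<in> (\<Union>n. {1 / real (Suc n)..})"
        by (auto simp: inverse_eq_divide intro!: exI[of _ n])
    qed (auto intro: less_le_trans[rotated])
    finally have "\<forall>\<^sub>F n in sequentially. 0 < measure D {1 / real (Suc n)..}"
      by (rule order_tendstoD(1)[OF _ pos])
    then obtain n where n: "0 < measure D {1 / real (Suc n)..}"
      unfolding eventually_sequentially by blast
    define d where "d = 1 / real (Suc n)"
    have d: "0 < d" "0 < measure D {d..}"
      using n by (auto simp: d_def)
    obtain n1 where n1: "n1 \<ge> 1" "0 < prob {\<omega> \<in> space M. \<forall>l::nat\<ge>1. linked d (d / real n1) 0 (int l) (\<lambda>e. X e \<omega>)}"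
      using linked_pos(1)[OF d] by blast
    obtain n2 where n2: "n2 \<ge> 1" "0 < prob {\<omega> \<in> space M. \<forall>l::nat\<ge>1. linked d (d / real n2) (- int l) 0 (\<lambda>e. X e \<omega>)}"
      using linked_pos(2)[OF d] by blast
    \<comment> \<open>The smaller slope serves both directions by \<open>linked_mono\<close>, and in
      this case smallness of \<open>c\<close> costs nothing for the jumping edges.\<close>
    define c where "c = min (d / real n1) (d / real n2)"
    have c: "0 < c"
      using d n1(1) n2(1) by (simp add: c_def)
    have "0 < prob (\<Inter>n. renewals d c 0 n)"
    proof (rule prob_renewals_pos[OF c])
      show "0 < measure D {..<2 * c}"
        using True c by simp
      have "prob {\<omega> \<in> space M. \<forall>l::nat\<ge>1. linked d (d / real n1) 0 (int l) (\<lambda>e. X e \<omega>)}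
          \<le> prob {\<omega> \<in> space M. \<forall>l::nat\<ge>1. linked d c 0 (int l) (\<lambda>e. X e \<omega>)}"
        by (intro finite_measure_mono sets_linked) (auto intro: linked_mono simp: c_def)
      then show "0 < prob {\<omega> \<in> space M. \<forall>l::nat\<ge>1. linked d c 0 (int l) (\<lambda>e. X e \<omega>)}"
        using n1(2) by simp
      have "prob {\<omega> \<in> space M. \<forall>l::nat\<ge>1. linked d (d / real n2) (- int l) 0 (\<lambda>e. X e \<omega>)}
          \<le> prob {\<omega> \<in> space M. \<forall>l::nat\<ge>1. linked d c (- int l) 0 (\<lambda>e. X e \<omega>)}"
        by (intro finite_measure_mono sets_linked) (auto intro: linked_mono simp: c_def)
      then show "0 < prob {\<omega> \<in> space M. \<forall>l::nat\<ge>1. linked d c (- int l) 0 (\<lambda>e. X e \<omega>)}"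
        using n2(2) by simp
    qed
    with c d show ?thesis
      by blast
  next
    case False
    then obtain \<epsilon> where \<epsilon>: "0 < \<epsilon>" "measure D {..<\<epsilon>} = 0"
      using measure_nonneg by (meson linorder_not_less order_antisym)
    \<comment> \<open>The lower bound \<open>\<epsilon>\<close> is doubled until it first fails to
      be one; the value just before, \<open>a\<close>, is a lower bound of the weights while
      \<open>2 * a\<close> is not.\<close>
    have "(\<lambda>k. measure D {..<2 ^ k * \<epsilon>}) \<longlonglongrightarrow> measure D (\<Union>k. {..<2 ^ k * \<epsilon>})"
      using \<epsilon>(1) by (intro D.finite_Lim_measure_incseq)
        (auto simp: sets_D incseq_def intro!: mult_right_mono power_increasing elim!: less_le_trans)
    also have "(\<Union>k. {..<2 ^ k * \<epsilon>}) = space D"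
    proof -
      have "\<exists>k. x < 2 ^ k * \<epsilon>" for x
        using real_arch_pow[of 2 "x / \<epsilon>"] \<epsilon>(1) by (auto simp: field_simps)
      then show ?thesis
        using sets_eq_imp_space_eq[OF sets_D] by auto
    qed
    finally have "\<forall>\<^sub>F k in sequentially. 0 < measure D {..<2 ^ k * \<epsilon>}"
      by (rule order_tendstoD(1)) (simp add: D.prob_space)
    then have "\<exists>k. 0 < measure D {..<2 ^ k * \<epsilon>}"
      unfolding eventually_sequentially by blast
    then obtain k where k: "0 < measure D {..<2 ^ k * \<epsilon>}" "\<And>i. i < k \<Longrightarrow> \<not> 0 < measure D {..<2 ^ i * \<epsilon>}"
      using exists_least_iff[of "\<lambda>k. 0 < measure D {..<2 ^ k * \<epsilon>}"] by blast
    obtain k' where k': "k = Suc k'"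
      using k(1) \<epsilon>(2) by (cases k) auto
    define a where "a = 2 ^ k' * \<epsilon>"
    have "\<not> 0 < measure D {..<a}"
      unfolding a_def by (rule k(2)) (simp add: k')
    then have a: "0 < a" "measure D {..<a} = 0" "0 < measure D {..<2 * a}"
      using k(1) \<epsilon>(1) by (auto simp: a_def k' mult.assoc not_less measure_le_0_iff)
    have "0 < prob (\<Inter>n. renewals a a 0 n)"
      using prob_linked_eq_1[OF a(2)] by (intro prob_renewals_pos a) auto
    with a show ?thesis
      by blast
  qed
  then show ?thesis
    using AE_infinite_renewals by blast
qed

end

section \<open>Transfer to weighted random graphs\<close>

text \<open>The translated vertex list of the linking path is a path of the graph, and each of its
  \<open>m\<close> edges contributes at least \<open>d\<close>.\<close>

lemma max_weight_ge:
  assumes "linked d c i j g"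
    and "\<And>k l. k < l \<Longrightarrow> d \<le> g (k, l) \<Longrightarrow> a (k + x) (l + x) = 1 \<and> d \<le> u (k + x) (l + x)"
  shows "ereal (c * (j - i)) \<le> max_weight u a (i + x) (j + x)"
proof -
  obtain m f where f: "f 0 = i" "f m = j" "\<And>k. k < m \<Longrightarrow> f k < f (Suc k) \<and> d \<le> g (f k, f (Suc k))"
      and m: "c * (j - i) \<le> d * real m"
    using assms(1) by (auto simp: linked_def relpow_fun_conv)
  define xs where "xs = map (\<lambda>k. f k + x) [0..<Suc m]"
  have nth: "xs ! k = f k + x" if "k \<le> m" for k
    using that by (simp add: xs_def nth_append)
  have len: "length xs = Suc m"
    by (simp add: xs_def)
  then have "xs \<noteq> []"
    by auto
  then have "xs \<in> paths a (i + x) (j + x)"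
    using f assms(2) by (auto simp: paths_def len nth successively_conv_nth hd_conv_nth last_conv_nth)
  then have "ereal (path_weight u xs) \<le> max_weight u a (i + x) (j + x)"
    unfolding max_weight_def by (rule SUP_upper)
  moreover have "d * real m \<le> path_weight u xs"
  proof -
    have "(\<Sum>k<m. d) \<le> (\<Sum>k<m. u (xs ! k) (xs ! Suc k))"
      using f(3) assms(2) by (intro sum_mono) (auto simp: nth)
    then show ?thesis
      by (simp add: path_weight_def len mult.commute)
  qed
  ultimately show ?thesis
    using m by (meson ereal_less_eq(3) order_trans)
qed

context weighted_random_dag
begin

section \<open>The law of the edge weights with absent edges set to 0\<close>

abbreviation edge_V :: "int \<times> int \<Rightarrow> 'a \<Rightarrow> real" where
  "edge_V \<equiv> \<lambda>(i, j). V i j"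

abbreviation edge_\<alpha> :: "int \<times> int \<Rightarrow> 'a \<Rightarrow> ereal" where
  "edge_\<alpha> \<equiv> \<lambda>(i, j). \<alpha> i j"

text \<open>The value 0 lies below every threshold \<open>d > 0\<close>, so an absent edge is never
  good.\<close>

definition edge_weight :: "int \<times> int \<Rightarrow> 'a \<Rightarrow> real" where
  "edge_weight e \<omega> = (if edge_\<alpha> e \<omega> = 1 then edge_V e \<omega> else 0)"

lemma edge_V_measurable: "e \<in> edge_set \<Longrightarrow> edge_V e \<in> borel_measurable M"
  using V_indep by (auto simp: indep_vars_def)

lemma edge_\<alpha>_measurable: "e \<in> edge_set \<Longrightarrow> edge_\<alpha> e \<in> borel_measurable M"
  using \<alpha>_indep by (auto simp: indep_vars_def)

text \<open>Independence of the two families splits the probability into a weight part and an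
  indicator part; independence within each family then splits these over the edges.\<close>

lemma prob_V_\<alpha>:
  assumes J: "J \<noteq> {}" "J \<subseteq> edge_set" "finite J"
    and A: "\<And>e. e \<in> J \<Longrightarrow> A e \<in> sets borel" and B: "\<And>e. e \<in> J \<Longrightarrow> B e \<in> sets borel"
  shows "prob (\<Inter>e\<in>J. edge_V e -` A e \<inter> edge_\<alpha> e -` B e \<inter> space M) =
    (\<Prod>e\<in>J. prob (edge_V e -` A e \<inter> space M) * prob (edge_\<alpha> e -` B e \<inter> space M))"
proof -
  let ?P = "Pi\<^sub>M edge_set (\<lambda>_. borel :: ereal measure)"
  \<comment> \<open>\<open>real_of_ereal\<close> undoes the embedding of the weights into
    \<open>ereal\<close> in \<open>V_\<alpha>_indep\<close>.\<close>
  define SA where "SA = {g \<in> space ?P. \<forall>e\<in>J. real_of_ereal (g e) \<in> A e}"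
  define SB where "SB = {g \<in> space ?P. \<forall>e\<in>J. g e \<in> B e}"
  have comp [measurable]: "(\<lambda>g. g e) \<in> borel_measurable ?P" if "e \<in> J" for e
    using that J by (intro measurable_component_singleton) auto
  have SASB: "SA \<in> sets ?P" "SB \<in> sets ?P"
    unfolding SA_def SB_def using A B J(3) by measurable
  have SA: "(\<lambda>(i, j)\<in>edge_set. ereal (V i j \<omega>)) \<in> SA \<longleftrightarrow> (\<forall>e\<in>J. edge_V e \<omega> \<in> A e)" for \<omega>
  proof -
    have "\<forall>e\<in>J. (\<lambda>(i, j)\<in>edge_set. ereal (V i j \<omega>)) e = ereal (edge_V e \<omega>)"
      using J(2) by auto
    moreover have "(\<lambda>(i, j)\<in>edge_set. ereal (V i j \<omega>)) \<in> space ?P"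
      by (simp add: space_PiM)
    ultimately show ?thesis
      unfolding SA_def by simp
  qed
  have SB: "(\<lambda>(i, j)\<in>edge_set. \<alpha> i j \<omega>) \<in> SB \<longleftrightarrow> (\<forall>e\<in>J. edge_\<alpha> e \<omega> \<in> B e)" for \<omega>
  proof -
    have "\<forall>e\<in>J. (\<lambda>(i, j)\<in>edge_set. \<alpha> i j \<omega>) e = edge_\<alpha> e \<omega>"
      using J(2) by auto
    moreover have "(\<lambda>(i, j)\<in>edge_set. \<alpha> i j \<omega>) \<in> space ?P"
      by (simp add: space_PiM)
    ultimately show ?thesis
      unfolding SB_def by simp
  qed
  from indep_varD[OF V_\<alpha>_indep SASB]
  have "prob ((\<lambda>\<omega>. (\<lambda>(i, j)\<in>edge_set. ereal (V i j \<omega>), \<lambda>(i, j)\<in>edge_set. \<alpha> i j \<omega>)) -` (SA \<times> SB) \<inter> space M) =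
      prob ((\<lambda>\<omega>. \<lambda>(i, j)\<in>edge_set. ereal (V i j \<omega>)) -` SA \<inter> space M) *
      prob ((\<lambda>\<omega>. \<lambda>(i, j)\<in>edge_set. \<alpha> i j \<omega>) -` SB \<inter> space M)" .
  moreover have "(\<lambda>\<omega>. \<lambda>(i, j)\<in>edge_set. ereal (V i j \<omega>)) -` SA \<inter> space M = (\<Inter>e\<in>J. edge_V e -` A e \<inter> space M)"
    using J(1) unfolding set_eq_iff vimage_def Int_iff mem_Collect_eq SA by blast
  moreover have "(\<lambda>\<omega>. \<lambda>(i, j)\<in>edge_set. \<alpha> i j \<omega>) -` SB \<inter> space M = (\<Inter>e\<in>J. edge_\<alpha> e -` B e \<inter> space M)"
    using J(1) unfolding set_eq_iff vimage_def Int_iff mem_Collect_eq SB by blast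
  moreover have "(\<lambda>\<omega>. (\<lambda>(i, j)\<in>edge_set. ereal (V i j \<omega>), \<lambda>(i, j)\<in>edge_set. \<alpha> i j \<omega>)) -` (SA \<times> SB) \<inter> space M
      = (\<Inter>e\<in>J. edge_V e -` A e \<inter> edge_\<alpha> e -` B e \<inter> space M)"
    using J(1) unfolding set_eq_iff vimage_def Int_iff mem_Collect_eq mem_Times_iff fst_conv snd_conv SA SB by blast
  ultimately have "prob (\<Inter>e\<in>J. edge_V e -` A e \<inter> edge_\<alpha> e -` B e \<inter> space M) =
      prob (\<Inter>e\<in>J. edge_V e -` A e \<inter> space M) * prob (\<Inter>e\<in>J. edge_\<alpha> e -` B e \<inter> space M)"
    by simp
  also have "prob (\<Inter>e\<in>J. edge_V e -` A e \<inter> space M) = (\<Prod>e\<in>J. prob (edge_V e -` A e \<inter> space M))"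
    using J A by (intro indep_varsD[OF V_indep]) auto
  also have "prob (\<Inter>e\<in>J. edge_\<alpha> e -` B e \<inter> space M) = (\<Prod>e\<in>J. prob (edge_\<alpha> e -` B e \<inter> space M))"
    using J B by (intro indep_varsD[OF \<alpha>_indep]) auto
  finally show ?thesis
    by (simp add: prod.distrib)
qed

lemma edge_weight_vimage:
  "edge_weight e -` C \<inter> space M = (edge_V e -` C \<inter> edge_\<alpha> e -` {1} \<inter> space M) \<union>
    (edge_V e -` (if 0 \<in> C then UNIV else {}) \<inter> edge_\<alpha> e -` (- {1}) \<inter> space M)"
  by (auto simp: edge_weight_def split: if_splits)

lemma edge_weight_measurable: "e \<in> edge_set \<Longrightarrow> edge_weight e \<in> borel_measurable M"
  unfolding edge_weight_def using edge_V_measurable[of e] edge_\<alpha>_measurable[of e] by measurable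

text \<open>The rectangles \<open>F e\<close> in weight and indicator are stable under intersection
  and independent over \<open>e\<close> by \<open>prob_V_\<alpha>\<close>, hence so are the
  sigma-algebras they generate. A preimage under \<open>edge_weight e\<close> is a union of two
  rectangles by \<open>edge_weight_vimage\<close>.\<close>

lemma indep_edge_weight: "indep_vars (\<lambda>_. borel) edge_weight edge_set"
proof -
  define F where "F = (\<lambda>e. {edge_V e -` A \<inter> edge_\<alpha> e -` B \<inter> space M |A B. A \<in> sets borel \<and> B \<in> sets borel})"
  have "indep_sets F edge_set"
  proof (rule indep_setsI)
    fix e assume "e \<in> edge_set"
    note [measurable] = edge_V_measurable[OF this] edge_\<alpha>_measurable[OF this]
    have "edge_V e -` A \<inter> edge_\<alpha> e -` B \<inter> space M \<in> events" if "A \<in> sets borel" "B \<in> sets borel" for A B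
    proof -
      have "(edge_V e -` A \<inter> space M) \<inter> (edge_\<alpha> e -` B \<inter> space M) \<in> events"
        using that by measurable
      then show ?thesis
        by (simp add: Int_ac)
    qed
    then show "F e \<subseteq> events"
      unfolding F_def by blast
  next
    fix E J
    assume J: "J \<noteq> {}" "J \<subseteq> edge_set" "finite J" and "\<forall>e\<in>J. E e \<in> F e"
    then have "\<forall>e\<in>J. \<exists>A B. E e = edge_V e -` A \<inter> edge_\<alpha> e -` B \<inter> space M \<and> A \<in> sets borel \<and> B \<in> sets borel"
      unfolding F_def by blast
    then obtain A B where AB: "\<forall>e\<in>J. E e = edge_V e -` A e \<inter> edge_\<alpha> e -` B e \<inter> space M \<and> A e \<in> sets borel \<and> B e \<in> sets borel"
      by metis
    have "prob (\<Inter>e\<in>J. E e) = prob (\<Inter>e\<in>J. edge_V e -` A e \<inter> edge_\<alpha> e -` B e \<inter> space M)"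
      using AB by simp
    also have "\<dots> = (\<Prod>e\<in>J. prob (edge_V e -` A e \<inter> space M) * prob (edge_\<alpha> e -` B e \<inter> space M))"
      using AB by (intro prob_V_\<alpha> J) auto
    also have "\<dots> = (\<Prod>e\<in>J. prob (E e))"
    proof (rule prod.cong)
      fix e assume "e \<in> J"
      then show "prob (edge_V e -` A e \<inter> space M) * prob (edge_\<alpha> e -` B e \<inter> space M) = prob (E e)"
        using prob_V_\<alpha>[of "{e}" A B] J AB by auto
    qed simp
    finally show "prob (\<Inter>e\<in>J. E e) = (\<Prod>e\<in>J. prob (E e))" .
  qed
  then have "indep_sets (\<lambda>e. sigma_sets (space M) (F e)) edge_set"
  proof (rule indep_sets_sigma)
    show "Int_stable (F e)" for e
      unfolding Int_stable_def
    proof (intro ballI)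
      fix S T assume "S \<in> F e" "T \<in> F e"
      then obtain A B A' B' where
          "S = edge_V e -` A \<inter> edge_\<alpha> e -` B \<inter> space M" "A \<in> sets borel" "B \<in> sets borel"
          "T = edge_V e -` A' \<inter> edge_\<alpha> e -` B' \<inter> space M" "A' \<in> sets borel" "B' \<in> sets borel"
        unfolding F_def by blast
      then show "S \<inter> T \<in> F e"
        unfolding F_def by (intro CollectI exI[of _ "A \<inter> A'"] exI[of _ "B \<inter> B'"]) auto
    qed
  qed
  then have "indep_sets (\<lambda>e. {edge_weight e -` C \<inter> space M |C. C \<in> sets borel}) edge_set"
  proof (rule indep_sets_mono_sets)
    fix e
    have "edge_weight e -` C \<inter> space M \<in> sigma_sets (space M) (F e)" if "C \<in> sets borel" for C
    proof -
      have "edge_V e -` C \<inter> edge_\<alpha> e -` {1} \<inter> space M \<in> F e"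
        using that unfolding F_def by (intro CollectI exI conjI) auto
      moreover have "edge_V e -` (if 0 \<in> C then UNIV else {}) \<inter> edge_\<alpha> e -` (- {1}) \<inter> space M \<in> F e"
        unfolding F_def by (intro CollectI exI conjI refl) auto
      ultimately show ?thesis
        unfolding edge_weight_vimage by (intro sigma_sets_Un sigma_sets.Basic)
    qed
    then show "{edge_weight e -` C \<inter> space M |C. C \<in> sets borel} \<subseteq> sigma_sets (space M) (F e)"
      by blast
  qed
  then show ?thesis
    unfolding indep_vars_def2 using edge_weight_measurable by blast
qed

text \<open>The complement of \<open>{1}\<close> stands in for \<open>{-\<infinity>}\<close>, since
  the indicators may take other values on a null set.\<close>

lemma prob_edge_present:
  assumes "e \<in> edge_set"
  shows "prob (edge_\<alpha> e -` {1} \<inter> space M) = p" "prob (edge_\<alpha> e -` (- {1}) \<inter> space M) = 1 - p"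
proof -
  obtain i j where e: "e = (i, j)" "i < j"
    using assms by (cases e) (auto simp: edge_set_def)
  have "edge_\<alpha> e -` {1} \<inter> space M = {\<omega> \<in> space M. \<alpha> i j \<omega> = 1}"
    by (auto simp: e)
  then show *: "prob (edge_\<alpha> e -` {1} \<inter> space M) = p"
    using \<alpha>_present e(2) by simp
  have "edge_\<alpha> e -` (- {1}) \<inter> space M = space M - (edge_\<alpha> e -` {1} \<inter> space M)"
    by auto
  then show "prob (edge_\<alpha> e -` (- {1}) \<inter> space M) = 1 - p"
    using * measurable_sets[OF edge_\<alpha>_measurable[OF assms], of "{1}"] by (simp add: prob_compl)
qed

text \<open>The right-hand side is the same for all edges, which shows that the edge weights are
  identically distributed.\<close>

lemma prob_edge_weight_in:
  assumes e: "e \<in> edge_set" and C: "C \<in> sets borel"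
  shows "prob (edge_weight e -` C \<inter> space M) = measure (distr N borel v) C * p + (if 0 \<in> C then 1 - p else 0)"
proof -
  obtain i j where ij: "e = (i, j)" "i < j"
    using e by (cases e) (auto simp: edge_set_def)
  note [measurable] = edge_V_measurable[OF e] edge_\<alpha>_measurable[OF e]
  have V_in: "prob (edge_V e -` C \<inter> space M) = measure (distr N borel v) C"
    using V_law[OF ij(2)] edge_V_measurable[OF e] C by (simp add: ij(1) measure_distr flip: V_law[OF ij(2)])
  have sets: "edge_V e -` A \<inter> edge_\<alpha> e -` B \<inter> space M \<in> events" if "A \<in> sets borel" "B \<in> sets borel" for A B
  proof -
    have "(edge_V e -` A \<inter> space M) \<inter> (edge_\<alpha> e -` B \<inter> space M) \<in> events"
      using that by measurable
    then show ?thesis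
      by (simp add: Int_ac)
  qed
  have prod: "prob (edge_V e -` A \<inter> edge_\<alpha> e -` B \<inter> space M)
      = prob (edge_V e -` A \<inter> space M) * prob (edge_\<alpha> e -` B \<inter> space M)" if "A \<in> sets borel" "B \<in> sets borel" for A B
    using prob_V_\<alpha>[of "{e}" "\<lambda>_. A" "\<lambda>_. B"] that e by simp
  have "prob (edge_weight e -` C \<inter> space M) = prob (edge_V e -` C \<inter> edge_\<alpha> e -` {1} \<inter> space M) +
      prob (edge_V e -` (if 0 \<in> C then UNIV else {}) \<inter> edge_\<alpha> e -` (- {1}) \<inter> space M)"
    unfolding edge_weight_vimage using C by (intro finite_measure_Union sets) auto
  also have "prob (edge_V e -` C \<inter> edge_\<alpha> e -` {1} \<inter> space M) = measure (distr N borel v) C * p"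
    using C by (subst prod) (auto simp: V_in prob_edge_present[OF e])
  also have "prob (edge_V e -` (if 0 \<in> C then UNIV else {}) \<inter> edge_\<alpha> e -` (- {1}) \<inter> space M) = (if 0 \<in> C then 1 - p else 0)"
    by (subst prod) (auto simp: prob_edge_present[OF e] prob_space)
  finally show ?thesis .
qed

lemma iid_edge_weight:
  assumes "integrable N (\<lambda>z. (v z)\<^sup>2)"
  shows "iid_edge_weights M edge_weight (distr M borel (edge_weight (0, 1)))"
proof
  have e: "(0, 1) \<in> edge_set"
    by (simp add: edge_set_def)
  note [measurable] = edge_weight_measurable[OF e] v_measurable
  have [measurable]: "V 0 1 \<in> borel_measurable M"
    using edge_V_measurable[OF e] by simp
  show "indep_vars (\<lambda>_. borel) edge_weight edge_set"
    by (rule indep_edge_weight)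
  show "distr M borel (edge_weight e) = distr M borel (edge_weight (0, 1))" if "e \<in> edge_set" for e
  proof (rule measure_eqI)
    fix C assume "C \<in> sets (distr M borel (edge_weight e))"
    then show "emeasure (distr M borel (edge_weight e)) C = emeasure (distr M borel (edge_weight (0, 1))) C"
      using edge_weight_measurable[OF that] edge_weight_measurable[OF e] prob_edge_weight_in[OF that] prob_edge_weight_in[OF e]
      by (simp add: emeasure_distr emeasure_eq_measure)
  qed simp
  have "integrable (distr N borel v) (\<lambda>x. x\<^sup>2)"
    using assms by (simp add: integrable_distr_eq)
  then have "integrable M (\<lambda>\<omega>. (V 0 1 \<omega>)\<^sup>2)"
    by (simp add: integrable_distr_eq flip: V_law[of 0 1])
  \<comment> \<open>The modified weight is either the original one or 0, so its square is
    dominated.\<close>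
  then have "integrable M (\<lambda>\<omega>. (edge_weight (0, 1) \<omega>)\<^sup>2)"
  proof (rule Bochner_Integration.integrable_bound)
    show "(\<lambda>\<omega>. (edge_weight (0, 1) \<omega>)\<^sup>2) \<in> borel_measurable M"
      by measurable
  qed (auto simp: edge_weight_def)
  then show "integrable (distr M borel (edge_weight (0, 1))) (\<lambda>x. x\<^sup>2)"
    by (simp add: integrable_distr_eq)
  interpret N: prob_space N
    by (rule prob_space_N)
  have "v -` {0<..} \<inter> space N = {z \<in> space N. 0 < v z}"
    by auto
  moreover have "N.prob {z \<in> space N. 0 < v z} = 1"
    using v_pos by (subst N.prob_Collect_eq_1) auto
  ultimately have "measure (distr N borel v) {0<..} = 1"
    by (simp add: measure_distr)
  then show "0 < measure (distr M borel (edge_weight (0, 1))) {0<..}"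
    using prob_edge_weight_in[OF e, of "{0<..}"] p_pos by (simp add: measure_distr)
qed

section \<open>From truncated renewals to renewal points\<close>

lemma AE_edges: "AE \<omega> in M. \<forall>i j. i < j \<longrightarrow> 0 < V i j \<omega> \<and> (\<alpha> i j \<omega> = 1 \<or> \<alpha> i j \<omega> = -\<infinity>)"
proof -
  have "AE \<omega> in M. 0 < V i j \<omega> \<and> (\<alpha> i j \<omega> = 1 \<or> \<alpha> i j \<omega> = -\<infinity>)" if ij: "i < j" for i j
  proof -
    have e: "(i, j) \<in> edge_set"
      using ij by (simp add: edge_set_def)
    have [measurable]: "V i j \<in> borel_measurable M" "\<alpha> i j \<in> borel_measurable M"
      using edge_V_measurable[OF e] edge_\<alpha>_measurable[OF e] by auto
    have "AE x in distr N borel v. 0 < x"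
      using v_pos v_measurable by (subst AE_distr_iff) auto
    then have "AE \<omega> in M. 0 < V i j \<omega>"
      unfolding V_law[OF ij, symmetric] by (subst (asm) AE_distr_iff) auto
    moreover have "AE \<omega> in M. \<alpha> i j \<omega> = 1 \<or> \<alpha> i j \<omega> = -\<infinity>"
    proof -
      have "{\<omega> \<in> space M. \<alpha> i j \<omega> = 1 \<or> \<alpha> i j \<omega> = -\<infinity>}
          = {\<omega> \<in> space M. \<alpha> i j \<omega> = 1} \<union> {\<omega> \<in> space M. \<alpha> i j \<omega> = -\<infinity>}"
        by auto
      then have "prob {\<omega> \<in> space M. \<alpha> i j \<omega> = 1 \<or> \<alpha> i j \<omega> = -\<infinity>} = 1"
        using \<alpha>_present[OF ij] \<alpha>_absent[OF ij] by (simp, subst finite_measure_Union) auto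
      then show ?thesis
        by (subst (asm) prob_Collect_eq_1) measurable
    qed
    ultimately show ?thesis
      by eventually_elim simp
  qed
  then show ?thesis
    by (simp add: AE_all_countable)
qed

text \<open>A deterministic inclusion: since \<open>d > 0\<close>, good edges are present with their
  true weight, so linking paths bound \<open>max_weight\<close> from below by
  \<open>max_weight_ge\<close>. Natural distances become integer ones through
  \<open>nat\<close>.\<close>

lemma renewals_subset_renewal_points:
  assumes edges: "\<And>i j. i < j \<Longrightarrow> 0 < V i j \<omega> \<and> (\<alpha> i j \<omega> = 1 \<or> \<alpha> i j \<omega> = -\<infinity>)"
    and d: "0 < d"
    and x: "\<And>n. renewal_upto d c n (\<lambda>e. edge_weight (shift_edge x e) \<omega>)"
  shows "x \<in> renewal_points (\<lambda>i j. V i j \<omega>) (\<lambda>i j. \<alpha> i j \<omega>) c"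
proof -
  let ?g = "\<lambda>e. edge_weight (shift_edge x e) \<omega>"
  have good: "\<alpha> (i + x) (j + x) \<omega> = 1 \<and> d \<le> V (i + x) (j + x) \<omega>" if "d \<le> ?g (i, j)" for i j
    using that d by (auto simp: edge_weight_def shift_edge_def split: if_splits)
  have "\<forall>n. renewal_upto d c n ?g"
    using x by blast
  note all = iffD1[OF all_renewal_upto_iff this]
  have links: "linked d c 0 (int l) ?g" "linked d c (- int l) 0 ?g" if "1 \<le> l" for l
    using all that by blast+
  have cross: "?g (- int j, int l) < c * (real l + real j)" if "1 \<le> j" "1 \<le> l" for j l
    using all that by blast+
  have 1: "ereal (c * l) \<le> max_weight (\<lambda>i j. V i j \<omega>) (\<lambda>i j. \<alpha> i j \<omega>) x (x + l)" if "1 \<le> l" for l :: int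
    using max_weight_ge[OF links(1)[of "nat l"], of "\<lambda>i j. \<alpha> i j \<omega>" x "\<lambda>i j. V i j \<omega>"] good that
    by (simp add: add.commute)
  have 2: "ereal (c * l) \<le> max_weight (\<lambda>i j. V i j \<omega>) (\<lambda>i j. \<alpha> i j \<omega>) (x - l) x" if "1 \<le> l" for l :: int
    using max_weight_ge[OF links(2)[of "nat l"], of "\<lambda>i j. \<alpha> i j \<omega>" x "\<lambda>i j. V i j \<omega>"] good that
    by simp
  have 3: "\<alpha> (x - j) (x + l) \<omega> * ereal (V (x - j) (x + l) \<omega>) < ereal (c * (l + j))" if "1 \<le> j" "1 \<le> l" for j l :: int
  proof -
    have e: "0 < V (x - j) (x + l) \<omega>" "\<alpha> (x - j) (x + l) \<omega> = 1 \<or> \<alpha> (x - j) (x + l) \<omega> = -\<infinity>"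
      using edges[of "x - j" "x + l"] that by auto
    have "edge_weight (x - j, x + l) \<omega> < c * (l + j)"
      using cross[of "nat j" "nat l"] that by (simp add: shift_edge_def add.commute algebra_simps)
    \<comment> \<open>If the edge is present, its weight is the one just bounded; if absent,
      positivity of \<open>V\<close> makes the product \<open>-\<infinity>\<close>.\<close>
    then show ?thesis
      using e by (auto simp: edge_weight_def)
  qed
  show ?thesis
    using 1 2 3 by (simp add: renewal_points_def)
qed

end

theorem lemma2p3:
  fixes M :: "'a measure" and N :: "'b measure" and v :: "'b \<Rightarrow> real" and p :: real
    and V :: "int \<Rightarrow> int \<Rightarrow> 'a \<Rightarrow> real" and \<alpha> :: "int \<Rightarrow> int \<Rightarrow> 'a \<Rightarrow> ereal"
  assumes "weighted_random_dag M N v p V \<alpha>"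
    and "integrable N (\<lambda>z. (v z)\<^sup>2)"
  shows "\<exists>c>0. AE \<omega> in M. infinite (renewal_points (\<lambda>i j. V i j \<omega>) (\<lambda>i j. \<alpha> i j \<omega>) c)"
proof -
  interpret weighted_random_dag M N v p V \<alpha>
    by fact
  interpret iid: iid_edge_weights M edge_weight "distr M borel (edge_weight (0, 1))"
    by (rule iid_edge_weight) fact
  obtain d c where "0 < d" "0 < c" and ae: "AE \<omega> in M. infinite {x. \<forall>n. \<omega> \<in> iid.renewals d c x n}"
    using iid.ex_AE_infinite_renewals by blast
  from ae AE_edges AE_space
  have "AE \<omega> in M. infinite (renewal_points (\<lambda>i j. V i j \<omega>) (\<lambda>i j. \<alpha> i j \<omega>) c)"
  proof eventually_elim
    case (elim \<omega>)
    have "{x. \<forall>n. \<omega> \<in> iid.renewals d c x n} \<subseteq> renewal_points (\<lambda>i j. V i j \<omega>) (\<lambda>i j. \<alpha> i j \<omega>) c"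
      using renewals_subset_renewal_points[OF _ \<open>0 < d\<close>] elim(2) unfolding iid.renewals_def by blast
    with elim(1) show ?case
      by (rule infinite_super[rotated])
  qed
  with \<open>0 < c\<close> show ?thesis
    by blast
qed

end
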